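(* Let $K$ be an algebraically closed field, let $G$ be an algebraic group over $K$, and let $\Gamma \leq G(K)$ be a subgroup. If $\Gamma$ is of Lang type, then $\Gamma$ is uniformly of Lang type.
   Context: Let $K$ be an algebraically closed field, $G$ an algebraic group over $K$, and $\Gamma \leq G(K)$ a subgroup. For $n \geq 1$, $G^n$ denotes the $n$-th Cartesian power of $G$, and $\Gamma^n \leq G^n(K)$ is the corresponding power of $\Gamma$. Subvarieties of $G^n$ are Zariski closed, not necessarily irreducible, and defined over $K$. The group operation is written additively, so $\gamma + H$ denotes the (left) translate of $H$ by $\gamma$; this is only notation and $G$ is not assumed to be commutative. $\Gamma$ is of *Lang type* if for every $n \geq 1$ and every subvariety $X$ of $G^n$, the set $X(K) \cap \Gamma^n$ is a finite (possibly empty) union of cosets of subgroups of $\Gamma^n$. An *algebraic family* $\{X_b\}_{b \in B}$ of subvarieties of $G^n$ is given by an algebraic variety $B$ over $K$ and a closed subvariety $X \subseteq G^n \times B$; for $b \in B(K)$, $X_b \subseteq G^n$ is the fibre of $X$ over $b$. $\Gamma$ is *uniformly of Lang type* if it is of Lang type and in addition: for every $n \geq 1$ and every algebraic family $\{X_b\}_{b \in B}$ of subvarieties of $G^n$ there is a finite sequence $H_1, \ldots, H_m$ of algebraic subgroups of $G^n$ (depending only on the family; repetitions in the sequence are allowed) such that for every $b \in B(K)$ there are a set $I \subseteq \{1, \ldots, m\}$ and points $\gamma_1, \ldots, \gamma_m \in \Gamma^n$ such that the Zariski closure of $X_b(K) \cap \Gamma^n$ in $G^n$ is $\bigcup_{i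 \in I} (\gamma_i + H_i)$ (the empty set if $I = \emptyset$). *)

theory Defs
  imports "HOL-Analysis.Function_Topology" "HOL-Algebra.Product_Groups"
    "HOL-Computational_Algebra.Polynomial"
begin

(* Classical varieties over an algebraically closed field, as sets of K-points carrying a topology
   and a sheaf of K-valued regular functions ("spaces with functions"). *)

record ('a, 'k) fun_space =
  zariski :: "'a topology"
  regular :: "'a set \<Rightarrow> ('a \<Rightarrow> 'k) \<Rightarrow> bool"

abbreviation points :: "('a, 'k, 'm) fun_space_scheme \<Rightarrow> 'a set" where
  "points X \<equiv> topspace (zariski X)"

(* regular X U f is only meaningful for open U and depends only on the restriction of f to U. *)
definition space_with_functions :: "('a, 'k::field) fun_space \<Rightarrow> bool" where
  "space_with_functions X \<longleftrightarrow>
    (\<forall>U f g. openin (zariski X) U \<and> (\<forall>x\<in>U. f x = g x) \<and> regular X U f \<longrightarrow> regular X U g) \<and>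
    (\<forall>U c. openin (zariski X) U \<longrightarrow> regular X U (\<lambda>_. c)) \<and>
    (\<forall>U f g. openin (zariski X) U \<and> regular X U f \<and> regular X U g \<longrightarrow>
       regular X U (\<lambda>x. f x + g x) \<and> regular X U (\<lambda>x. f x * g x)) \<and>
    (\<forall>\<U> f. (\<forall>U\<in>\<U>. openin (zariski X) U) \<longrightarrow>
       (regular X (\<Union>\<U>) f \<longleftrightarrow> (\<forall>U\<in>\<U>. regular X U f))) \<and>
    (\<forall>U f. openin (zariski X) U \<and> regular X U f \<longrightarrow>
       openin (zariski X) {x \<in> U. f x \<noteq> 0} \<and>
       regular X {x \<in> U. f x \<noteq> 0} (\<lambda>x. inverse (f x)))"

definition morphism ::
  "('a, 'k) fun_space \<Rightarrow> ('b, 'k) fun_space \<Rightarrow> ('a \<Rightarrow> 'b) \<Rightarrow> bool" where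
  "morphism X Y \<phi> \<longleftrightarrow> continuous_map (zariski X) (zariski Y) \<phi> \<and>
    (\<forall>V f. openin (zariski Y) V \<and> regular Y V f \<longrightarrow>
       regular X {x \<in> points X. \<phi> x \<in> V} (f \<circ> \<phi>))"

definition isomorphic :: "('a, 'k) fun_space \<Rightarrow> ('b, 'k) fun_space \<Rightarrow> bool" where
  "isomorphic X Y \<longleftrightarrow> (\<exists>\<phi> \<psi>. morphism X Y \<phi> \<and> morphism Y X \<psi> \<and>
     (\<forall>x\<in>points X. \<psi> (\<phi> x) = x) \<and> (\<forall>y\<in>points Y. \<phi> (\<psi> y) = y))"

(* The induced structure on a subset: regular functions are locally restrictions of regular
   functions on open subsets of X. *)
definition induced_space :: "('a, 'k) fun_space \<Rightarrow> 'a set \<Rightarrow> ('a, 'k) fun_space" where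
  "induced_space X Z = \<lparr>zariski = subtopology (zariski X) Z,
     regular = (\<lambda>U f. \<forall>x\<in>U. \<exists>W g. openin (zariski X) W \<and> x \<in> W \<and> W \<inter> Z \<subseteq> U \<and>
       regular X W g \<and> (\<forall>y\<in>W \<inter> Z. f y = g y))\<rparr>"

(* The structure generated by a collection F of functions f with prescribed domains D: the open
   sets are generated by the nonvanishing loci, and the regular functions are locally quotients
   of members of F with a common domain. *)
definition fraction_space :: "('a set \<times> ('a \<Rightarrow> 'k::field)) set \<Rightarrow> ('a, 'k) fun_space" where
  "fraction_space F =
    (let T = topology_generated_by {{x \<in> D. f x \<noteq> 0} |D f. (D, f) \<in> F}
     in \<lparr>zariski = T,
         regular = (\<lambda>U h. \<forall>x\<in>U. \<exists>W D p q. openin T W \<and> x \<in> W \<and> W \<subseteq> U \<inter> D \<and>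
           (D, p) \<in> F \<and> (D, q) \<in> F \<and> (\<forall>y\<in>W. q y \<noteq> 0 \<and> h y = p y / q y))\<rparr>)"

(* Polynomial functions in the coordinates x 0, ..., x (n - 1). *)
inductive_set polynomial_functions :: "nat \<Rightarrow> ((nat \<Rightarrow> 'k::field) \<Rightarrow> 'k) set" for n where
  const: "(\<lambda>_. c) \<in> polynomial_functions n"
| coord: "i < n \<Longrightarrow> (\<lambda>x. x i) \<in> polynomial_functions n"
| add: "p \<in> polynomial_functions n \<Longrightarrow> q \<in> polynomial_functions n \<Longrightarrow>
    (\<lambda>x. p x + q x) \<in> polynomial_functions n"
| mult: "p \<in> polynomial_functions n \<Longrightarrow> q \<in> polynomial_functions n \<Longrightarrow>
    (\<lambda>x. p x * q x) \<in> polynomial_functions n"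

definition affine_space :: "nat \<Rightarrow> (nat \<Rightarrow> 'k::field, 'k) fun_space" where
  "affine_space n = fraction_space {({..<n} \<rightarrow>\<^sub>E UNIV, p) |p. p \<in> polynomial_functions n}"

definition affine_variety :: "('a, 'k::field) fun_space \<Rightarrow> bool" where
  "affine_variety X \<longleftrightarrow> (\<exists>n Z. closedin (zariski (affine_space n :: (nat \<Rightarrow> 'k, 'k) fun_space)) Z \<and>
     isomorphic X (induced_space (affine_space n) Z))"

(* The basic open sets of X \<times> Y are the nonvanishing loci, in products U \<times> V of open sets, of
   the functions in the image of the tensor product of the rings of regular functions. *)
definition prod_space ::
  "('a, 'k::field) fun_space \<Rightarrow> ('b, 'k) fun_space \<Rightarrow> ('a \<times> 'b, 'k) fun_space" where
  "prod_space X Y = fraction_space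
    {(U \<times> V, \<lambda>(x, y). \<Sum>j<m. g j x * h j y) |U V (m::nat) g h.
       openin (zariski X) U \<and> openin (zariski Y) V \<and>
       (\<forall>j<m. regular X U (g j) \<and> regular Y V (h j))}"

(* The n-fold analogue; points are extensional functions on {..<n}, as in product_group. *)
definition power_space :: "nat \<Rightarrow> ('a, 'k::field) fun_space \<Rightarrow> (nat \<Rightarrow> 'a, 'k) fun_space" where
  "power_space n X = fraction_space
    {(\<Pi>\<^sub>E i\<in>{..<n}. U i, \<lambda>x. \<Sum>j<m. \<Prod>i<n. g j i (x i)) |U (m::nat) g.
       (\<forall>i<n. openin (zariski X) (U i)) \<and> (\<forall>j<m. \<forall>i<n. regular X (U i) (g j i))}"

(* Not necessarily irreducible. *)
definition variety :: "('a, 'k::field) fun_space \<Rightarrow> bool" where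
  "variety X \<longleftrightarrow> space_with_functions X \<and>
    (\<exists>\<U>. finite \<U> \<and> \<Union>\<U> = points X \<and>
       (\<forall>U\<in>\<U>. openin (zariski X) U \<and> affine_variety (induced_space X U))) \<and>
    closedin (zariski (prod_space X X)) {(x, x) |x. x \<in> points X}"

locale algebraic_group = group G for G :: "'a monoid" (structure) +
  fixes V :: "('a, 'k::alg_closed_field) fun_space"
  assumes variety: "variety V"
    and carrier_eq_points: "carrier G = points V"
    and mult_morphism: "morphism (prod_space V V) V (\<lambda>(x, y). x \<otimes> y)"
    and inv_morphism: "morphism V V (\<lambda>x. inv x)"

abbreviation group_power :: "nat \<Rightarrow> 'a monoid \<Rightarrow> (nat \<Rightarrow> 'a) monoid" where
  "group_power n G \<equiv> product_group {..<n} (\<lambda>_. G)"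

abbreviation (input) set_power :: "nat \<Rightarrow> 'a set \<Rightarrow> (nat \<Rightarrow> 'a) set" where
  "set_power n \<Gamma> \<equiv> {..<n} \<rightarrow>\<^sub>E \<Gamma>"

definition Lang_type :: "'a monoid \<Rightarrow> ('a, 'k::field) fun_space \<Rightarrow> 'a set \<Rightarrow> bool" where
  "Lang_type G V \<Gamma> \<longleftrightarrow>
    (\<forall>n\<ge>1. \<forall>X. closedin (zariski (power_space n V)) X \<longrightarrow>
       (\<exists>\<C>. finite \<C> \<and> X \<inter> set_power n \<Gamma> = \<Union>\<C> \<and>
          (\<forall>C\<in>\<C>. \<exists>\<gamma> S. \<gamma> \<in> set_power n \<Gamma> \<and> subgroup S (group_power n G) \<and>
             S \<subseteq> set_power n \<Gamma> \<and> C = \<gamma> <#\<^bsub>group_power n G\<^esub> S)))"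

definition algebraic_subgroup ::
  "nat \<Rightarrow> 'a monoid \<Rightarrow> ('a, 'k::field) fun_space \<Rightarrow> (nat \<Rightarrow> 'a) set \<Rightarrow> bool" where
  "algebraic_subgroup n G V H \<longleftrightarrow>
     subgroup H (group_power n G) \<and> closedin (zariski (power_space n V)) H"

(* The type argument is the type in which the points of the parameter varieties B live; a HOL
   formula cannot quantify over it, so it is left as a type variable in theorems. *)
definition uniformly_Lang_type ::
  "'b itself \<Rightarrow> 'a monoid \<Rightarrow> ('a, 'k::field) fun_space \<Rightarrow> 'a set \<Rightarrow> bool" where
  "uniformly_Lang_type TYPE('b) G V \<Gamma> \<longleftrightarrow> Lang_type G V \<Gamma> \<and>
    (\<forall>n\<ge>1. \<forall>(B :: ('b, 'k) fun_space) X.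
       variety B \<and> closedin (zariski (prod_space (power_space n V) B)) X \<longrightarrow>
       (\<exists>m H. (\<forall>i\<in>{1..m::nat}. algebraic_subgroup n G V (H i)) \<and>
          (\<forall>b\<in>points B. \<exists>I \<gamma>. I \<subseteq> {1..m} \<and> (\<forall>i\<in>{1..m}. \<gamma> i \<in> set_power n \<Gamma>) \<and>
             zariski (power_space n V) closure_of ({x. (x, b) \<in> X} \<inter> set_power n \<Gamma>) =
               (\<Union>i\<in>I. \<gamma> i <#\<^bsub>group_power n G\<^esub> H i))))"

end

theory Submission
  imports Defs "HOL-Library.Function_Algebras"
begin

text \<open>
  By noetherianity of \<open>G\<^sup>n \<times> B\<close>, the complement of \<open>X\<close> is a finite union of loci
  \<open>{(x, b) \<in> U \<times> W. (\<Sum>j. g j x * h j b) \<noteq> 0}\<close>. So \<open>X\<^sub>b \<inter> \<Gamma>\<^sup>n\<close> is a finite intersection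
  of sets of solutions \<open>x\<close> of one equation \<open>\<Sum>j. g j x * c j = 0\<close>, with unknown coefficients
  \<open>c j = h j b\<close> in \<open>K\<close>. The coefficients can be traded for parameters in \<open>\<Gamma>\<close>: if some solution
  \<open>x\<^sub>1\<close> has \<open>g k x\<^sub>1 \<noteq> 0\<close>, it determines \<open>c k\<close> from the other coefficients, and substituting
  gives an equation with fewer terms whose functions \<open>g\<close> also depend on \<open>x\<^sub>1 \<in> \<Gamma>\<^sup>n\<close>; otherwise
  the solution set does not depend on \<open>c\<close>. After finitely many steps \<open>X\<^sub>b \<inter> \<Gamma>\<^sup>n\<close> is built
  from fibres, over points of powers of \<open>\<Gamma>\<close>, of finitely many closed subsets of powers of \<open>G\<close>.
  As \<open>\<Gamma>\<close> is of Lang type, each of those closed sets meets the power of \<open>\<Gamma>\<close> in finitely many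
  cosets \<open>\<gamma> + S\<close>, and a nonempty fibre of \<open>\<gamma> + S\<close> is a coset of the fibre of \<open>S\<close> over the
  identity, which does not depend on the parameters. Finally, the Zariski closure of a coset of
  a subgroup is a coset of the closure of that subgroup.
\<close>

section \<open>Hilbert's basis theorem for subrings\<close>

text \<open>The obstacle is that the coefficients \<open>h j b\<close> range over \<open>K\<close>,
  while the Lang type hypothesis speaks only of points of \<Gamma> and of one closed set at a time.
  Once all parameters lie in powers of \<Gamma>, a family of fibres is controlled by a single closed
  set, and the hypothesis needs no uniformity of its own. That the unknown coefficients enter
  linearly is built into the product topology, whose basic functions are sums of products
  \<open>g j x * h j y\<close>. Besides a finite set of subgroups, a common bound on the number of
  cosets has to be carried along, because each index of the final sequence contributes at most one
  coset; both pass to finite unions of families and to intersections. Noetherianity is obtained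
  without proving that products of affine varieties are affine: on each box of affine open sets a
  noetherian ring of functions defines a noetherian topology, which only has to refine the Zariski
  topology there. Since this ring is given by functions and not by polynomials, the basis theorem is
  proved for subrings of an arbitrary commutative ring.\<close>

definition is_subring :: "'r::comm_ring_1 set \<Rightarrow> bool" where
  "is_subring R \<longleftrightarrow> 0 \<in> R \<and> 1 \<in> R \<and> (\<forall>x\<in>R. - x \<in> R) \<and>
     (\<forall>x\<in>R. \<forall>y\<in>R. x + y \<in> R \<and> x * y \<in> R)"

inductive_set ideal_span :: "'r::comm_ring_1 set \<Rightarrow> 'r set \<Rightarrow> 'r set" for R P where
  zero: "0 \<in> ideal_span R P"
| gen: "p \<in> P \<Longrightarrow> p \<in> ideal_span R P"
| add: "x \<in> ideal_span R P \<Longrightarrow> y \<in> ideal_span R P \<Longrightarrow> x + y \<in> ideal_span R P"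
| mult: "r \<in> R \<Longrightarrow> x \<in> ideal_span R P \<Longrightarrow> r * x \<in> ideal_span R P"

text \<open>\<open>P\<close> is any subset, and the generators are chosen from \<open>P\<close>
  itself. This is what later turns finite generation into a finite subcover.\<close>

definition noetherian_subring :: "'r::comm_ring_1 set \<Rightarrow> bool" where
  "noetherian_subring R \<longleftrightarrow> is_subring R \<and>
     (\<forall>P\<subseteq>R. \<exists>F\<subseteq>P. finite F \<and> P \<subseteq> ideal_span R F)"

lemma ideal_span_subset: "P \<subseteq> ideal_span R Q \<Longrightarrow> ideal_span R P \<subseteq> ideal_span R Q"
proof
  fix x assume PQ: "P \<subseteq> ideal_span R Q" and "x \<in> ideal_span R P"
  from this(2) show "x \<in> ideal_span R Q"
    using PQ by induction (auto intro: ideal_span.intros)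
qed

lemma ideal_span_mono: "P \<subseteq> Q \<Longrightarrow> ideal_span R P \<subseteq> ideal_span R Q"
  by (rule ideal_span_subset) (auto intro: ideal_span.gen)

lemma ideal_span_finite:
  assumes "x \<in> ideal_span R P"
  shows "\<exists>F\<subseteq>P. finite F \<and> x \<in> ideal_span R F"
  using assms
proof induction
  case zero
  then show ?case by (intro exI[of _ "{}"]) (auto intro: ideal_span.zero)
next
  case (gen p)
  then show ?case by (intro exI[of _ "{p}"]) (auto intro: ideal_span.gen)
next
  case (add x y)
  then obtain F G where "F \<subseteq> P" "finite F" "x \<in> ideal_span R F"
    "G \<subseteq> P" "finite G" "y \<in> ideal_span R G" by blast
  then show ?case
    using ideal_span_mono[of F "F \<union> G" R] ideal_span_mono[of G "F \<union> G" R]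
    by (intro exI[of _ "F \<union> G"]) (auto intro: ideal_span.add)
next
  case (mult r x)
  then show ?case by (meson ideal_span.mult)
qed

lemma ideal_span_finite_subset:
  assumes "finite G" "G \<subseteq> ideal_span R P"
  shows "\<exists>F\<subseteq>P. finite F \<and> G \<subseteq> ideal_span R F"
proof -
  have "\<forall>x\<in>G. \<exists>F\<subseteq>P. finite F \<and> x \<in> ideal_span R F"
    using assms(2) ideal_span_finite by blast
  then obtain F where F: "\<forall>x\<in>G. F x \<subseteq> P \<and> finite (F x) \<and> x \<in> ideal_span R (F x)" by metis
  show ?thesis
  proof (intro exI[of _ "\<Union>x\<in>G. F x"] conjI subsetI)
    fix x assume "x \<in> G"
    then show "x \<in> ideal_span R (\<Union>x\<in>G. F x)"
      using F ideal_span_mono[of "F x" "\<Union>x\<in>G. F x" R] by blast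
  qed (use F assms(1) in auto)
qed

lemma ideal_span_uminus:
  assumes "is_subring R" "x \<in> ideal_span R P"
  shows "- x \<in> ideal_span R P"
proof -
  have "- 1 \<in> R" using assms(1) by (auto simp: is_subring_def)
  from ideal_span.mult[OF this assms(2)] show ?thesis by simp
qed

text \<open>
  \<open>t\<close> need not be transcendental over \<open>R\<close>: the leading coefficient argument below only uses the
  existence of an expression as a polynomial in \<open>t\<close>, not its uniqueness.
\<close>

fun polys_below :: "'r::comm_ring_1 set \<Rightarrow> 'r \<Rightarrow> nat \<Rightarrow> 'r set" where
  "polys_below R t 0 = {0}"
| "polys_below R t (Suc d) = {a + c * t ^ d |a c. a \<in> polys_below R t d \<and> c \<in> R}"

lemma polys_below_SucI:
  "a \<in> polys_below R t d \<Longrightarrow> c \<in> R \<Longrightarrow> x = a + c * t ^ d \<Longrightarrow> x \<in> polys_below R t (Suc d)"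
  by auto

section \<open>Polynomial expressions in one element, and the basis theorem for
  \<open>R[t]\<close>\<close>

context
  fixes R :: "'r::comm_ring_1 set" and t :: 'r
  assumes R: "is_subring R"
begin

lemma polys_below_zero: "0 \<in> polys_below R t d"
proof (induction d)
  case (Suc d)
  then show ?case using R by (auto simp: is_subring_def intro!: exI[of _ 0])
qed simp

lemma polys_below_Suc: "polys_below R t d \<subseteq> polys_below R t (Suc d)"
proof
  fix x assume "x \<in> polys_below R t d"
  then show "x \<in> polys_below R t (Suc d)"
    by (rule polys_below_SucI[of _ _ _ _ 0]) (use R in \<open>auto simp: is_subring_def\<close>)
qed

lemma polys_below_mono: "d \<le> e \<Longrightarrow> polys_below R t d \<subseteq> polys_below R t e"
  by (rule lift_Suc_mono_le[of "polys_below R t"]) (use polys_below_Suc in auto)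

lemma polys_below_add:
  "x \<in> polys_below R t d \<Longrightarrow> y \<in> polys_below R t d \<Longrightarrow> x + y \<in> polys_below R t d"
proof (induction d arbitrary: x y)
  case (Suc d)
  then obtain a c a' c' where *: "x = a + c * t ^ d" "y = a' + c' * t ^ d"
    "a \<in> polys_below R t d" "a' \<in> polys_below R t d" "c \<in> R" "c' \<in> R" by auto
  have "x + y = (a + a') + (c + c') * t ^ d" by (simp add: * algebra_simps)
  moreover have "c + c' \<in> R" using R * by (auto simp: is_subring_def)
  ultimately show ?case using Suc.IH * polys_below_SucI by blast
qed simp

lemma polys_below_scale:
  "r \<in> R \<Longrightarrow> x \<in> polys_below R t d \<Longrightarrow> r * t ^ e * x \<in> polys_below R t (d + e)"
proof (induction d arbitrary: x)
  case 0
  then show ?case using polys_below_zero by simp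
next
  case (Suc d)
  then obtain a c where *: "x = a + c * t ^ d" "a \<in> polys_below R t d" "c \<in> R" by auto
  have "r * t ^ e * x = r * t ^ e * a + (r * c) * t ^ (d + e)"
    by (simp add: * algebra_simps power_add)
  moreover have "r * c \<in> R" using R * Suc by (auto simp: is_subring_def)
  ultimately show ?case using Suc * polys_below_SucI[of "r * t ^ e * a" R t "d + e"] by auto
qed

lemma polys_below_mult:
  "x \<in> polys_below R t d \<Longrightarrow> y \<in> polys_below R t e \<Longrightarrow> x * y \<in> polys_below R t (d + e)"
proof (induction d arbitrary: x)
  case 0
  then show ?case using polys_below_zero by simp
next
  case (Suc d)
  then obtain a c where *: "x = a + c * t ^ d" "a \<in> polys_below R t d" "c \<in> R" by auto
  have "c * t ^ d * y \<in> polys_below R t (d + e)"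
    using polys_below_scale[OF \<open>c \<in> R\<close> Suc.prems(2), of d] by (simp add: add.commute)
  then have "a * y + c * t ^ d * y \<in> polys_below R t (d + e)"
    using Suc * polys_below_add by blast
  then show ?case using polys_below_Suc by (auto simp: * distrib_right simp del: polys_below.simps)
qed

lemma is_subring_adjoin: "is_subring (\<Union>d. polys_below R t d)"
  unfolding is_subring_def
proof (intro conjI ballI)
  have "1 \<in> R" using R by (simp add: is_subring_def)
  then have "1 \<in> polys_below R t (Suc 0)" by (intro polys_below_SucI[of 0]) auto
  then show "1 \<in> (\<Union>d. polys_below R t d)" by blast
  show "0 \<in> (\<Union>d. polys_below R t d)" using polys_below_zero by blast
next
  fix x assume "x \<in> (\<Union>d. polys_below R t d)"
  then obtain d where x: "x \<in> polys_below R t d" by blast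
  have "- 1 \<in> R" using R by (auto simp: is_subring_def)
  from polys_below_scale[OF this x, of 0] show "- x \<in> (\<Union>d. polys_below R t d)" by auto
  fix y assume "y \<in> (\<Union>d. polys_below R t d)"
  then obtain e where y: "y \<in> polys_below R t e" by blast
  show "x * y \<in> (\<Union>d. polys_below R t d)" using polys_below_mult[OF x y] by blast
  have "x + y \<in> polys_below R t (max d e)"
    using x y polys_below_mono[of d "max d e"] polys_below_mono[of e "max d e"]
    by (intro polys_below_add) auto
  then show "x + y \<in> (\<Union>d. polys_below R t d)" by blast
qed

lemma power_mult_in_adjoin: "r \<in> R \<Longrightarrow> r * t ^ e \<in> (\<Union>d. polys_below R t d)"
proof -
  assume "r \<in> R"
  then have "r * t ^ e \<in> polys_below R t (Suc e)"
    using polys_below_zero by (intro polys_below_SucI[of 0]) auto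
  then show ?thesis by (auto simp del: polys_below.simps)
qed

text \<open>Hilbert's argument: the leading coefficients of the ideal \<open>I\<close> in degree
  \<open>d\<close> form an increasing chain that is controlled by finitely many coefficients from
  degrees up to some \<open>D\<close>. Lifts of these to \<open>I\<close> generate \<open>I\<close>,
  as leading terms can be cancelled one degree at a time.\<close>

lemma noetherian_adjoin:
  assumes noeth: "noetherian_subring R"
  shows "noetherian_subring (\<Union>d. polys_below R t d)" (is "noetherian_subring ?S")
  unfolding noetherian_subring_def
proof (intro conjI allI impI)
  show S: "is_subring ?S" by (rule is_subring_adjoin)
  fix P assume "P \<subseteq> ?S"
  define I where "I = ideal_span ?S P"
  \<comment> \<open>All possible leading coefficients in degree \<open>d\<close>. One element may
    have several expressions in \<open>t\<close> and then contributes several coefficients, which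
    does no harm.\<close>
  define L where "L d = {c \<in> R. \<exists>a\<in>polys_below R t d. a + c * t ^ d \<in> I}" for d
  have I_sub: "I \<subseteq> ?S"
  proof
    fix x assume "x \<in> I"
    then show "x \<in> ?S"
      unfolding I_def using S \<open>P \<subseteq> ?S\<close> by induction (auto simp: is_subring_def)
  qed
  have t: "t \<in> ?S" using power_mult_in_adjoin[of 1 1] R by (simp add: is_subring_def)
  have L_Suc: "L d \<subseteq> L (Suc d)" for d
  proof
    fix c assume "c \<in> L d"
    then obtain a where a: "c \<in> R" "a \<in> polys_below R t d" "a + c * t ^ d \<in> I"
      by (auto simp: L_def)
    have "1 \<in> R" using R by (simp add: is_subring_def)
    from polys_below_scale[OF this a(2), of 1] have "t * a \<in> polys_below R t (Suc d)"
      by (simp del: polys_below.simps)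
    moreover have "t * a + c * t ^ Suc d \<in> I"
      using ideal_span.mult[OF t a(3)[unfolded I_def]] unfolding I_def
      by (simp add: algebra_simps)
    ultimately show "c \<in> L (Suc d)" using a(1) by (auto simp: L_def simp del: polys_below.simps)
  qed
  have L_mono: "d \<le> e \<Longrightarrow> L d \<subseteq> L e" for d e
    by (rule lift_Suc_mono_le[of L]) (use L_Suc in auto)
  have "\<exists>F\<subseteq>Q. finite F \<and> Q \<subseteq> ideal_span R F" if "Q \<subseteq> R" for Q
    using noeth that unfolding noetherian_subring_def by blast
  note fg = this
  have "(\<Union>d. L d) \<subseteq> R" by (auto simp: L_def)
  from fg[OF this] obtain F where F: "F \<subseteq> (\<Union>d. L d)" "finite F" "(\<Union>d. L d) \<subseteq> ideal_span R F"
    by blast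
  \<comment> \<open>The finite set \<open>F\<close> generates the leading coefficients of all
    degrees. As \<open>L\<close> is increasing, \<open>F\<close> fits into a single degree
    \<open>D\<close>, beyond which no new generators are needed.\<close>
  have "\<exists>D. F \<subseteq> L D"
    using F(2,1)
  proof induction
    case (insert x F)
    then obtain D d where "F \<subseteq> L D" "x \<in> L d" by auto
    then have "insert x F \<subseteq> L (max D d)"
      using L_mono[of D "max D d"] L_mono[of d "max D d"] by auto
    then show ?case by blast
  qed simp
  then obtain D where D: "F \<subseteq> L D" by blast
  have "\<forall>d. \<exists>F\<subseteq>L d. finite F \<and> L d \<subseteq> ideal_span R F"
    using fg by (simp add: L_def)
  then obtain E where E: "\<And>d. E d \<subseteq> L d" "\<And>d. finite (E d)" "\<And>d. L d \<subseteq> ideal_span R (E d)"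
    by metis
  have "\<forall>d. \<forall>c\<in>L d. \<exists>f\<in>I. \<exists>a\<in>polys_below R t d. f = a + c * t ^ d"
    by (auto simp: L_def)
  then obtain lift where lift: "\<And>d c. c \<in> L d \<Longrightarrow> lift d c \<in> I \<and>
      (\<exists>a\<in>polys_below R t d. lift d c = a + c * t ^ d)" by metis
  \<comment> \<open>One lift for every generator of \<open>L d\<close>, in each of the degrees
    \<open>0\<close> to \<open>D\<close>.\<close>
  define G where "G = (\<Union>d\<le>D. lift d ` E d)"
  have G_sub: "G \<subseteq> I" using lift E(1) by (fastforce simp: G_def)
  have lead: "\<exists>g\<in>ideal_span ?S G. \<exists>a\<in>polys_below R t d. g = a + c * t ^ d"
    if "d \<le> D" "c \<in> ideal_span R (E d)" for c d
    using that(2)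
  proof induction
    case zero
    then show ?case using polys_below_zero ideal_span.zero by force
  next
    case (gen c)
    then have "lift d c \<in> G" using that(1) by (auto simp: G_def)
    then show ?case using lift[of c d] E(1)[of d] gen by (meson ideal_span.gen subsetD)
  next
    case (add x y)
    then obtain g g' a a' where *: "g \<in> ideal_span ?S G" "g' \<in> ideal_span ?S G"
      "a \<in> polys_below R t d" "a' \<in> polys_below R t d" "g = a + x * t ^ d" "g' = a' + y * t ^ d"
      by blast
    have "g + g' = (a + a') + (x + y) * t ^ d" by (simp add: * algebra_simps)
    then show ?case using ideal_span.add[OF *(1,2)] polys_below_add[OF *(3,4)] by blast
  next
    case (mult r x)
    then obtain g a where *: "g \<in> ideal_span ?S G" "a \<in> polys_below R t d" "g = a + x * t ^ d"
      by blast
    have "r * g = r * a + (r * x) * t ^ d" by (simp add: * algebra_simps)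
    moreover have "r * g \<in> ideal_span ?S G"
      using ideal_span.mult[OF _ *(1), of r] power_mult_in_adjoin[OF mult(1), of 0] by simp
    moreover have "r * a \<in> polys_below R t d"
      using polys_below_scale[OF mult(1) *(2), of 0] by simp
    ultimately show ?case by blast
  qed
  have lead': "\<exists>g\<in>ideal_span ?S G. \<exists>a\<in>polys_below R t d. g = a + c * t ^ d" if "c \<in> L d" for c d
  proof (cases "d \<le> D")
    case True
    then show ?thesis using lead that E(3) by blast
  next
    \<comment> \<open>Above degree \<open>D\<close>, the coefficient is realised in degree
      \<open>D\<close> and the result is multiplied by \<open>t ^ (d - D)\<close>.\<close>
    case False
    have "F \<subseteq> ideal_span R (E D)" using D E(3) by blast
    then have "c \<in> ideal_span R (E D)" using F(3) that ideal_span_subset by blast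
    then obtain g a where *: "g \<in> ideal_span ?S G" "a \<in> polys_below R t D" "g = a + c * t ^ D"
      using lead by blast
    have 1: "1 \<in> R" using R by (simp add: is_subring_def)
    have "t ^ (d - D) * g = t ^ (d - D) * a + c * t ^ (d - D + D)"
      by (simp add: * algebra_simps power_add)
    moreover have "t ^ (d - D) * g \<in> ideal_span ?S G"
      using ideal_span.mult[OF power_mult_in_adjoin[OF 1] *(1), of "d - D"] by simp
    moreover have "t ^ (d - D) * a \<in> polys_below R t d"
      using polys_below_scale[OF 1 *(2), of "d - D"] False by simp
    ultimately show ?thesis using False by auto
  qed
  have span_G: "ideal_span ?S G \<subseteq> I"
    using G_sub ideal_span_subset unfolding I_def by blast
  have "f \<in> ideal_span ?S G" if "f \<in> I" "f \<in> polys_below R t d" for f d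
    using that
  proof (induction d arbitrary: f)
    case 0
    then show ?case by (simp add: ideal_span.zero)
  next
    case (Suc d)
    then obtain a c where *: "f = a + c * t ^ d" "a \<in> polys_below R t d" "c \<in> R" by auto
    then have "c \<in> L d" using Suc.prems(1) by (auto simp: L_def)
    \<comment> \<open>An element of the span of \<open>G\<close> with the same leading term:
      subtracting it lowers the degree bound and stays inside \<open>I\<close>.\<close>
    then obtain g a' where g: "g \<in> ideal_span ?S G" "a' \<in> polys_below R t d" "g = a' + c * t ^ d"
      using lead' by blast
    have "- 1 \<in> R" using R by (auto simp: is_subring_def)
    from polys_below_add[OF *(2) polys_below_scale[OF this g(2), of 0, simplified]]
    have "f - g \<in> polys_below R t d" by (simp add: * g(3))
    moreover have "f + - g \<in> I"
      unfolding I_def using Suc.prems(1) ideal_span_uminus[OF S] g(1) span_G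
      by (intro ideal_span.add) (auto simp: I_def)
    ultimately have "f - g \<in> ideal_span ?S G" using Suc.IH by simp
    from ideal_span.add[OF this g(1)] show ?case by simp
  qed
  then have I_G: "I \<subseteq> ideal_span ?S G" using I_sub by blast
  \<comment> \<open>\<open>G\<close> was chosen in \<open>I\<close>, not in \<open>P\<close>; each
    of its finitely many elements is a combination of finitely many members of
    \<open>P\<close>.\<close>
  have "finite G" using E(2) by (simp add: G_def)
  then obtain F' where F': "F' \<subseteq> P" "finite F'" "G \<subseteq> ideal_span ?S F'"
    using ideal_span_finite_subset G_sub unfolding I_def by meson
  have "P \<subseteq> I" unfolding I_def by (auto intro: ideal_span.gen)
  then have "P \<subseteq> ideal_span ?S F'" using I_G ideal_span_subset[OF F'(3)] by blast
  then show "\<exists>F\<subseteq>P. finite F \<and> P \<subseteq> ideal_span ?S F" using F' by blast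
qed

end

lemma noetherian_subring_extend:
  assumes "finite T" "noetherian_subring R"
  shows "\<exists>S. noetherian_subring S \<and> R \<subseteq> S \<and> T \<subseteq> S"
  using assms
proof induction
  case (insert t T)
  then obtain S where S: "noetherian_subring S" "R \<subseteq> S" "T \<subseteq> S" by blast
  then have sub: "is_subring S" by (simp add: noetherian_subring_def)
  have "S \<subseteq> (\<Union>d. polys_below S t d)" using power_mult_in_adjoin[OF sub, of _ t 0] by auto
  moreover have "t \<in> (\<Union>d. polys_below S t d)"
    using power_mult_in_adjoin[OF sub, of 1 t 1] sub by (simp add: is_subring_def)
  ultimately show ?case using noetherian_adjoin[OF sub S(1)] S by blast
qed auto

text \<open>The constants form a copy of the field, so one nonzero member of \<open>P\<close>
  already generates; if there is none, the empty set does.\<close>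

lemma noetherian_subring_constants:
  "noetherian_subring (range (\<lambda>c::'k::field. (\<lambda>_::'x. c)))"
  unfolding noetherian_subring_def
proof (intro conjI allI impI)
  show "is_subring (range (\<lambda>c::'k. (\<lambda>_::'x. c)))"
    by (auto simp: is_subring_def fun_eq_iff image_iff)
  fix P :: "('x \<Rightarrow> 'k) set" assume P: "P \<subseteq> range (\<lambda>c _. c)"
  show "\<exists>F\<subseteq>P. finite F \<and> P \<subseteq> ideal_span (range (\<lambda>c _. c)) F"
  proof (cases "P \<subseteq> {0}")
    case True
    then show ?thesis by (intro exI[of _ "{}"]) (auto intro: ideal_span.zero)
  next
    case False
    then obtain c where c: "(\<lambda>_. c) \<in> P" "c \<noteq> 0" using P by (fastforce simp: fun_eq_iff)
    have "P \<subseteq> ideal_span (range (\<lambda>c _. c)) {\<lambda>_. c}"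
    proof
      fix p assume "p \<in> P"
      then obtain d where "p = (\<lambda>_. d)" using P by blast
      then have "p = (\<lambda>_. d / c) * (\<lambda>_. c)" using c by (auto simp: fun_eq_iff)
      then show "p \<in> ideal_span (range (\<lambda>c _. c)) {\<lambda>_. c}"
        by (auto intro: ideal_span.intros)
    qed
    then show ?thesis using c by blast
  qed
qed

section \<open>Spaces with functions and fraction spaces\<close>

context
  fixes X :: "('a, 'k::field) fun_space"
  assumes X: "space_with_functions X"
begin

private lemmas sheaf_laws =
  X[unfolded space_with_functions_def, THEN conjunct1]
  X[unfolded space_with_functions_def, THEN conjunct2, THEN conjunct1]
  X[unfolded space_with_functions_def, THEN conjunct2, THEN conjunct2, THEN conjunct1]
  X[unfolded space_with_functions_def, THEN conjunct2, THEN conjunct2, THEN conjunct2, THEN conjunct1]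
  X[unfolded space_with_functions_def, THEN conjunct2, THEN conjunct2, THEN conjunct2, THEN conjunct2]

lemma regular_cong:
  "openin (zariski X) U \<Longrightarrow> regular X U f \<Longrightarrow> (\<And>x. x \<in> U \<Longrightarrow> f x = g x) \<Longrightarrow> regular X U g"
  using sheaf_laws(1) by blast

lemma regular_const: "openin (zariski X) U \<Longrightarrow> regular X U (\<lambda>_. c)"
  using sheaf_laws(2) by blast

lemma regular_add:
  "openin (zariski X) U \<Longrightarrow> regular X U f \<Longrightarrow> regular X U g \<Longrightarrow> regular X U (\<lambda>x. f x + g x)"
  using sheaf_laws(3) by blast

lemma regular_mult:
  "openin (zariski X) U \<Longrightarrow> regular X U f \<Longrightarrow> regular X U g \<Longrightarrow> regular X U (\<lambda>x. f x * g x)"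
  using sheaf_laws(3) by blast

lemma regular_Union:
  "(\<And>U. U \<in> \<U> \<Longrightarrow> openin (zariski X) U) \<Longrightarrow> regular X (\<Union>\<U>) f \<longleftrightarrow> (\<forall>U\<in>\<U>. regular X U f)"
  using sheaf_laws(4) by blast

lemma openin_nonvanishing:
  "openin (zariski X) U \<Longrightarrow> regular X U f \<Longrightarrow> openin (zariski X) {x \<in> U. f x \<noteq> 0}"
  using sheaf_laws(5) by blast

lemma regular_inverse:
  "openin (zariski X) U \<Longrightarrow> regular X U f \<Longrightarrow>
    regular X {x \<in> U. f x \<noteq> 0} (\<lambda>x. inverse (f x))"
  using sheaf_laws(5) by blast

text \<open>Restriction is contained in the gluing equivalence, applied to the cover of
  \<open>U\<close> by \<open>U\<close> and \<open>W\<close>.\<close>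

lemma regular_subset:
  assumes "openin (zariski X) U" "openin (zariski X) W" "W \<subseteq> U" "regular X U f"
  shows "regular X W f"
  using regular_Union[of "{U, W}" f] assms by (auto simp: Un_absorb2)

lemma regular_locally:
  assumes "\<And>x. x \<in> U \<Longrightarrow> \<exists>W. openin (zariski X) W \<and> x \<in> W \<and> W \<subseteq> U \<and> regular X W f"
  shows "regular X U f"
proof -
  let ?\<U> = "{W. openin (zariski X) W \<and> W \<subseteq> U \<and> regular X W f}"
  have "\<Union>?\<U> = U" using assms by blast
  then show ?thesis using regular_Union[of ?\<U> f] by auto
qed

lemma regular_diff:
  assumes "openin (zariski X) U" "regular X U f" "regular X U g"
  shows "regular X U (\<lambda>x. f x - g x)"
  using regular_add[OF assms(1,2) regular_mult[OF assms(1) regular_const[OF assms(1), of "-1"] assms(3)]]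
  by simp

lemma regular_sum:
  "finite J \<Longrightarrow> openin (zariski X) U \<Longrightarrow> (\<And>j. j \<in> J \<Longrightarrow> regular X U (f j)) \<Longrightarrow>
    regular X U (\<lambda>x. \<Sum>j\<in>J. f j x)"
  by (induction J rule: finite_induct) (simp_all add: regular_const regular_add)

lemma regular_prod:
  "finite J \<Longrightarrow> openin (zariski X) U \<Longrightarrow> (\<And>j. j \<in> J \<Longrightarrow> regular X U (f j)) \<Longrightarrow>
    regular X U (\<lambda>x. \<Prod>j\<in>J. f j x)"
  by (induction J rule: finite_induct) (simp_all add: regular_const regular_mult)

end

section \<open>Morphisms and induced spaces\<close>

lemma morphism_continuous: "morphism X Y \<phi> \<Longrightarrow> continuous_map (zariski X) (zariski Y) \<phi>"
  by (simp add: morphism_def)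

lemma morphism_openin_vimage:
  "morphism X Y \<phi> \<Longrightarrow> openin (zariski Y) V \<Longrightarrow> openin (zariski X) {x \<in> points X. \<phi> x \<in> V}"
  using openin_continuous_map_preimage[OF morphism_continuous] .

lemma morphism_regular:
  "morphism X Y \<phi> \<Longrightarrow> openin (zariski Y) V \<Longrightarrow> regular Y V f \<Longrightarrow>
    regular X {x \<in> points X. \<phi> x \<in> V} (\<lambda>x. f (\<phi> x))"
  by (simp add: morphism_def comp_def)

lemma morphism_in_points: "morphism X Y \<phi> \<Longrightarrow> x \<in> points X \<Longrightarrow> \<phi> x \<in> points Y"
  using continuous_map_image_subset_topspace[OF morphism_continuous] by blast

lemma morphismI:
  assumes "continuous_map (zariski X) (zariski Y) \<phi>"
    and "\<And>V f. openin (zariski Y) V \<Longrightarrow> regular Y V f \<Longrightarrow>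
      regular X {x \<in> points X. \<phi> x \<in> V} (\<lambda>x. f (\<phi> x))"
  shows "morphism X Y \<phi>"
  using assms by (simp add: morphism_def comp_def)

lemma morphism_comp:
  assumes \<phi>: "morphism X Y \<phi>" and \<psi>: "morphism Y Z \<psi>"
  shows "morphism X Z (\<lambda>x. \<psi> (\<phi> x))"
proof (rule morphismI)
  show "continuous_map (zariski X) (zariski Z) (\<lambda>x. \<psi> (\<phi> x))"
    using continuous_map_compose[OF assms[THEN morphism_continuous]] by (simp add: comp_def)
  fix W f assume W: "openin (zariski Z) W" "regular Z W f"
  have "{x \<in> points X. \<phi> x \<in> {y \<in> points Y. \<psi> y \<in> W}} = {x \<in> points X. \<psi> (\<phi> x) \<in> W}"
    using morphism_in_points[OF \<phi>] by blast
  then show "regular X {x \<in> points X. \<psi> (\<phi> x) \<in> W} (\<lambda>x. f (\<psi> (\<phi> x)))"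
    using morphism_regular[OF \<phi> morphism_openin_vimage[OF \<psi> W(1)] morphism_regular[OF \<psi> W]] by simp
qed

lemma morphism_cong:
  assumes X: "space_with_functions X" and \<phi>: "morphism X Y \<phi>"
    and eq: "\<And>x. x \<in> points X \<Longrightarrow> \<phi> x = \<psi> x"
  shows "morphism X Y \<psi>"
proof (rule morphismI)
  show "continuous_map (zariski X) (zariski Y) \<psi>"
    using continuous_map_eq[OF morphism_continuous[OF \<phi>] eq] .
  fix V f assume V: "openin (zariski Y) V" "regular Y V f"
  have set_eq: "{x \<in> points X. \<psi> x \<in> V} = {x \<in> points X. \<phi> x \<in> V}" using eq by auto
  show "regular X {x \<in> points X. \<psi> x \<in> V} (\<lambda>x. f (\<psi> x))"
    unfolding set_eq
    by (rule regular_cong[OF X morphism_openin_vimage[OF \<phi> V(1)] morphism_regular[OF \<phi> V]])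
      (use eq in auto)
qed

lemma morphism_id: "morphism X X (\<lambda>x. x)"
proof (rule morphismI)
  fix V f assume V: "openin (zariski X) V" "regular X V f"
  then have "{x \<in> points X. x \<in> V} = V" using openin_subset by blast
  then show "regular X {x \<in> points X. x \<in> V} f" using V by simp
qed simp

lemma morphism_const:
  assumes "space_with_functions X" "c \<in> points Y"
  shows "morphism X Y (\<lambda>_. c)"
proof (rule morphismI)
  fix V f assume "openin (zariski Y) V" "regular Y V f"
  then show "regular X {x \<in> points X. c \<in> V} (\<lambda>_. f c)"
    using regular_const[OF assms(1)] by (cases "c \<in> V") simp_all
qed (use assms in simp)

lemma points_induced_space: "points (induced_space X Z) = points X \<inter> Z"
  by (simp add: induced_space_def)

lemma morphism_induced_space_inclusion: "morphism (induced_space X Z) X (\<lambda>x. x)"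
proof (rule morphismI)
  show "continuous_map (zariski (induced_space X Z)) (zariski X) (\<lambda>x. x)"
    by (simp add: induced_space_def continuous_map_from_subtopology)
  fix V f assume "openin (zariski X) V" "regular X V f"
  then show "regular (induced_space X Z) {x \<in> points (induced_space X Z). x \<in> V} f"
    by (auto simp: induced_space_def dest: openin_subset)
qed

lemma morphism_to_induced_space:
  assumes X: "space_with_functions X" and \<phi>: "morphism X Y \<phi>"
    and Z: "\<And>x. x \<in> points X \<Longrightarrow> \<phi> x \<in> Z"
  shows "morphism X (induced_space Y Z) \<phi>"
proof (rule morphismI)
  show "continuous_map (zariski X) (zariski (induced_space Y Z)) \<phi>"
    using morphism_continuous[OF \<phi>] Z
    by (auto simp: induced_space_def continuous_map_in_subtopology)
  fix V f assume V: "openin (zariski (induced_space Y Z)) V" "regular (induced_space Y Z) V f"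
  show "regular X {x \<in> points X. \<phi> x \<in> V} (\<lambda>x. f (\<phi> x))"
  proof (rule regular_locally[OF X])
    fix x assume x: "x \<in> {x \<in> points X. \<phi> x \<in> V}"
    with V obtain W g where W: "openin (zariski Y) W" "\<phi> x \<in> W" "W \<inter> Z \<subseteq> V" "regular Y W g"
      "\<forall>y\<in>W \<inter> Z. f y = g y" by (auto simp: induced_space_def)
    let ?U = "{x \<in> points X. \<phi> x \<in> W}"
    have "openin (zariski X) ?U" using morphism_openin_vimage[OF \<phi> W(1)] .
    moreover from this have "regular X ?U (\<lambda>x. f (\<phi> x))"
      by (rule regular_cong[OF X _ morphism_regular[OF \<phi> W(1,4)]])
        (use W(5) Z in auto)
    ultimately show "\<exists>W. openin (zariski X) W \<and> x \<in> W \<and> W \<subseteq> {x \<in> points X. \<phi> x \<in> V} \<and>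
        regular X W (\<lambda>x. f (\<phi> x))"
      using x W Z by blast
  qed
qed

section \<open>Fraction spaces\<close>

text \<open>The closure properties under which the nonvanishing loci form a base and local quotients
  form a sheaf. Products give intersections of loci; sums, products and constants give common
  denominators on a common domain.\<close>

definition fraction_family :: "('a set \<times> ('a \<Rightarrow> 'k::field)) set \<Rightarrow> bool" where
  "fraction_family F \<longleftrightarrow>
    (\<forall>D f c. (D, f) \<in> F \<longrightarrow> (D, \<lambda>_. c) \<in> F) \<and>
    (\<forall>D f E g. (D, f) \<in> F \<and> (E, g) \<in> F \<longrightarrow>
       (D \<inter> E, \<lambda>x. f x + g x) \<in> F \<and> (D \<inter> E, \<lambda>x. f x * g x) \<in> F)"

lemma openin_fraction_space_basic:
  "(D, f) \<in> F \<Longrightarrow> openin (zariski (fraction_space F)) {x \<in> D. f x \<noteq> 0}"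
  by (auto simp: fraction_space_def Let_def intro!: topology_generated_by_Basis)

lemma points_fraction_space: "points (fraction_space F) = (\<Union>(D, f)\<in>F. {x \<in> D. f x \<noteq> 0})"
  by (auto simp: fraction_space_def Let_def)

lemma regular_fraction_space:
  "regular (fraction_space F) U h \<longleftrightarrow> (\<forall>x\<in>U. \<exists>W D p q. openin (zariski (fraction_space F)) W \<and>
     x \<in> W \<and> W \<subseteq> U \<inter> D \<and> (D, p) \<in> F \<and> (D, q) \<in> F \<and> (\<forall>y\<in>W. q y \<noteq> 0 \<and> h y = p y / q y))"
  by (simp add: fraction_space_def Let_def)

lemma regular_fraction_spaceI:
  assumes "\<And>x. x \<in> U \<Longrightarrow> \<exists>W D p q. openin (zariski (fraction_space F)) W \<and> x \<in> W \<and> W \<subseteq> U \<inter> D \<and>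
    (D, p) \<in> F \<and> (D, q) \<in> F \<and> (\<forall>y\<in>W. q y \<noteq> 0 \<and> h y = p y / q y)"
  shows "regular (fraction_space F) U h"
  using assms unfolding regular_fraction_space by (rule ballI)

lemma regular_fraction_spaceE:
  assumes "regular (fraction_space F) U h" "x \<in> U"
  obtains W D p q where "openin (zariski (fraction_space F)) W" "x \<in> W" "W \<subseteq> U" "W \<subseteq> D"
    "(D, p) \<in> F" "(D, q) \<in> F" "\<And>y. y \<in> W \<Longrightarrow> q y \<noteq> 0" "\<And>y. y \<in> W \<Longrightarrow> h y = p y / q y"
proof -
  from bspec[OF assms(1)[unfolded regular_fraction_space] assms(2)]
  obtain W D p q where *: "openin (zariski (fraction_space F)) W" "x \<in> W" "W \<subseteq> U \<inter> D"
    "(D, p) \<in> F" "(D, q) \<in> F" "\<forall>y\<in>W. q y \<noteq> 0 \<and> h y = p y / q y" by (elim exE conjE)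
  show thesis by (rule that[of W D p q]) (use * in auto)
qed

lemma fraction_familyD:
  assumes "fraction_family F"
  shows "(D, f) \<in> F \<Longrightarrow> (D, \<lambda>_. c) \<in> F"
    and "(D, f) \<in> F \<Longrightarrow> (E, g) \<in> F \<Longrightarrow> (D \<inter> E, \<lambda>x. f x + g x) \<in> F"
    and "(D, f) \<in> F \<Longrightarrow> (E, g) \<in> F \<Longrightarrow> (D \<inter> E, \<lambda>x. f x * g x) \<in> F"
  using assms unfolding fraction_family_def by blast+

context
  fixes F :: "('a set \<times> ('a \<Rightarrow> 'k::field)) set"
  assumes F: "fraction_family F"
begin

text \<open>The generating loci are already a base, since the locus of a product on
  \<open>D \<inter> E\<close> is the intersection of the two loci.\<close>

lemma fraction_space_base:
  assumes "openin (zariski (fraction_space F)) U" "x \<in> U"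
  shows "\<exists>D f. (D, f) \<in> F \<and> x \<in> D \<and> f x \<noteq> 0 \<and> {y \<in> D. f y \<noteq> 0} \<subseteq> U"
proof -
  have "generate_topology_on {{x \<in> D. f x \<noteq> 0} |D f. (D, f) \<in> F} U"
    using assms(1) by (simp add: fraction_space_def Let_def openin_topology_generated_by_iff)
  then show ?thesis using assms(2)
  proof induction
    case (Int a b)
    then obtain D f E g where *: "(D, f) \<in> F" "x \<in> D" "f x \<noteq> 0" "{y \<in> D. f y \<noteq> 0} \<subseteq> a"
      "(E, g) \<in> F" "x \<in> E" "g x \<noteq> 0" "{y \<in> E. g y \<noteq> 0} \<subseteq> b" by auto
    then show ?case
      using fraction_familyD(3)[OF F *(1,5)]
      by (intro exI[of _ "D \<inter> E"] exI[of _ "\<lambda>x. f x * g x"]) auto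
  qed fast+
qed

lemma openin_fraction_space_domain: "(D, f) \<in> F \<Longrightarrow> openin (zariski (fraction_space F)) D"
  using openin_fraction_space_basic[OF fraction_familyD(1)[OF F], of D f 1] by simp

lemma regular_fraction_space_member:
  assumes f: "(D, f) \<in> F"
  shows "regular (fraction_space F) D f"
  by (rule regular_fraction_spaceI, rule exI[of _ D], rule exI[of _ D], rule exI[of _ f],
      rule exI[of _ "\<lambda>_. 1"])
    (use f openin_fraction_space_domain[OF f] fraction_familyD(1)[OF F f] in auto)

lemma space_with_functions_fraction_space: "space_with_functions (fraction_space F)"
proof -
  let ?X = "fraction_space F"
  let ?T = "zariski ?X"
  note ring = fraction_familyD(2,3)[OF F]
  have cong: "regular ?X U g" if "regular ?X U f" "\<forall>x\<in>U. f x = g x" for U f g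
  proof (rule regular_fraction_spaceI)
    fix x assume "x \<in> U"
    from regular_fraction_spaceE[OF that(1) this] obtain W D p q where
      *: "openin ?T W" "x \<in> W" "W \<subseteq> U" "W \<subseteq> D" "(D, p) \<in> F" "(D, q) \<in> F"
      "\<And>y. y \<in> W \<Longrightarrow> q y \<noteq> 0" "\<And>y. y \<in> W \<Longrightarrow> f y = p y / q y" by metis
    show "\<exists>W D p q. openin ?T W \<and> x \<in> W \<and> W \<subseteq> U \<inter> D \<and> (D, p) \<in> F \<and> (D, q) \<in> F \<and>
        (\<forall>y\<in>W. q y \<noteq> 0 \<and> g y = p y / q y)"
      by (rule exI[of _ W], rule exI[of _ D], rule exI[of _ p], rule exI[of _ q])
        (use * that(2)[rule_format, symmetric] in auto)
  qed
  have const: "regular ?X U (\<lambda>_. c)" if U: "openin ?T U" for U c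
  proof (rule regular_fraction_spaceI)
    fix x assume "x \<in> U"
    from fraction_space_base[OF U this] obtain D f where
      D: "(D, f) \<in> F" "x \<in> D" "f x \<noteq> 0" "{y \<in> D. f y \<noteq> 0} \<subseteq> U" by metis
    show "\<exists>W D p q. openin ?T W \<and> x \<in> W \<and> W \<subseteq> U \<inter> D \<and> (D, p) \<in> F \<and> (D, q) \<in> F \<and>
        (\<forall>y\<in>W. q y \<noteq> 0 \<and> c = p y / q y)"
      by (rule exI[of _ "{y \<in> D. f y \<noteq> 0}"], rule exI[of _ D], rule exI[of _ "\<lambda>_. c"],
          rule exI[of _ "\<lambda>_. 1"], use D openin_fraction_space_basic[OF D(1)] fraction_familyD(1)[OF F D(1)] in auto)
  qed
  have common: "\<exists>W D p q p' q'. openin ?T W \<and> x \<in> W \<and> W \<subseteq> U \<inter> D \<and> (D, p) \<in> F \<and> (D, q) \<in> F \<and>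
      (D, p') \<in> F \<and> (D, q') \<in> F \<and>
      (\<forall>y\<in>W. q y \<noteq> 0 \<and> f y = p y / q y \<and> q' y \<noteq> 0 \<and> g y = p' y / q' y)"
    if f: "regular ?X U f" and g: "regular ?X U g" and x: "x \<in> U" for U f g x
  proof -
    from regular_fraction_spaceE[OF f x] obtain W D p q where
      *: "openin ?T W" "x \<in> W" "W \<subseteq> U" "W \<subseteq> D" "(D, p) \<in> F" "(D, q) \<in> F"
      "\<And>y. y \<in> W \<Longrightarrow> q y \<noteq> 0" "\<And>y. y \<in> W \<Longrightarrow> f y = p y / q y" by metis
    from regular_fraction_spaceE[OF g x] obtain W' D' p' q' where
      **: "openin ?T W'" "x \<in> W'" "W' \<subseteq> U" "W' \<subseteq> D'" "(D', p') \<in> F" "(D', q') \<in> F"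
      "\<And>y. y \<in> W' \<Longrightarrow> q' y \<noteq> 0" "\<And>y. y \<in> W' \<Longrightarrow> g y = p' y / q' y" by metis
    \<comment> \<open>Multiplying by the constant 1 on the other domain restricts a member of the
      family to the intersection.\<close>
    have D: "(D \<inter> D', h) \<in> F" if "(D, h) \<in> F" for h
      using ring(2)[OF that fraction_familyD(1)[OF F **(5), of 1]] by simp
    have D': "(D \<inter> D', h) \<in> F" if "(D', h) \<in> F" for h
      using ring(2)[OF fraction_familyD(1)[OF F *(5), of 1] that] by simp
    show ?thesis
      by (rule exI[of _ "W \<inter> W'"], rule exI[of _ "D \<inter> D'"], rule exI[of _ p], rule exI[of _ q],
          rule exI[of _ p'], rule exI[of _ q'], use * ** D D' in auto)
  qed
  have add_mult: "regular ?X U (\<lambda>x. f x + g x)" "regular ?X U (\<lambda>x. f x * g x)"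
    if "regular ?X U f" "regular ?X U g" for U f g
  proof -
    {
      fix x assume "x \<in> U"
      from common[OF that this] obtain W D p q p' q' where
        *: "openin ?T W" "x \<in> W" "W \<subseteq> U \<inter> D" "(D, p) \<in> F" "(D, q) \<in> F" "(D, p') \<in> F" "(D, q') \<in> F"
        "\<forall>y\<in>W. q y \<noteq> 0 \<and> f y = p y / q y \<and> q' y \<noteq> 0 \<and> g y = p' y / q' y"
        by (elim exE conjE)
      have qq: "(D, \<lambda>x. q x * q' x) \<in> F" using ring(2)[OF *(5,7)] by simp
      have pp: "(D, \<lambda>x. p x * p' x) \<in> F" using ring(2)[OF *(4,6)] by simp
      have pq: "(D, \<lambda>x. p x * q' x + q x * p' x) \<in> F"
        using ring(1)[OF ring(2)[OF *(4,7)] ring(2)[OF *(5,6)]] by simp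
      have s: "\<forall>y\<in>W. q y * q' y \<noteq> 0 \<and> f y + g y = (p y * q' y + q y * p' y) / (q y * q' y)"
        using *(8) by (auto simp: field_simps)
      have m: "\<forall>y\<in>W. q y * q' y \<noteq> 0 \<and> f y * g y = (p y * p' y) / (q y * q' y)"
        using *(8) by (auto simp: field_simps)
      have "\<exists>W D p q. openin ?T W \<and> x \<in> W \<and> W \<subseteq> U \<inter> D \<and> (D, p) \<in> F \<and> (D, q) \<in> F \<and>
          (\<forall>y\<in>W. q y \<noteq> 0 \<and> f y + g y = p y / q y)"
        by (intro exI conjI) (rule *(1-3) qq pq s)+
      moreover have "\<exists>W D p q. openin ?T W \<and> x \<in> W \<and> W \<subseteq> U \<inter> D \<and> (D, p) \<in> F \<and> (D, q) \<in> F \<and>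
          (\<forall>y\<in>W. q y \<noteq> 0 \<and> f y * g y = p y / q y)"
        by (intro exI conjI) (rule *(1-3) qq pp m)+
      moreover note calculation
    }
    then show "regular ?X U (\<lambda>x. f x + g x)" "regular ?X U (\<lambda>x. f x * g x)"
      by (simp_all add: regular_fraction_space)
  qed
  have restrict: "regular ?X U f" if f: "regular ?X (\<Union>\<U>) f" and U: "U \<in> \<U>" "openin ?T U" for U \<U> f
  proof (rule regular_fraction_spaceI)
    fix x assume x: "x \<in> U"
    then have "x \<in> \<Union>\<U>" using U(1) by blast
    from regular_fraction_spaceE[OF f this] obtain W D p q where
      *: "openin ?T W" "x \<in> W" "W \<subseteq> D" "(D, p) \<in> F" "(D, q) \<in> F"
      "\<And>y. y \<in> W \<Longrightarrow> q y \<noteq> 0" "\<And>y. y \<in> W \<Longrightarrow> f y = p y / q y" by metis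
    show "\<exists>W D p q. openin ?T W \<and> x \<in> W \<and> W \<subseteq> U \<inter> D \<and> (D, p) \<in> F \<and> (D, q) \<in> F \<and>
        (\<forall>y\<in>W. q y \<noteq> 0 \<and> f y = p y / q y)"
      by (rule exI[of _ "W \<inter> U"], rule exI[of _ D], rule exI[of _ p], rule exI[of _ q]) (use * x U in auto)
  qed
  have glue: "regular ?X (\<Union>\<U>) f" if f: "\<forall>U\<in>\<U>. regular ?X U f" for \<U> f
  proof (rule regular_fraction_spaceI)
    fix x assume "x \<in> \<Union>\<U>"
    then obtain U where U: "U \<in> \<U>" "x \<in> U" by blast
    from regular_fraction_spaceE[OF bspec[OF f U(1)] U(2)] obtain W D p q where
      *: "openin ?T W" "x \<in> W" "W \<subseteq> U" "W \<subseteq> D" "(D, p) \<in> F" "(D, q) \<in> F"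
      "\<And>y. y \<in> W \<Longrightarrow> q y \<noteq> 0" "\<And>y. y \<in> W \<Longrightarrow> f y = p y / q y" by metis
    show "\<exists>W D p q. openin ?T W \<and> x \<in> W \<and> W \<subseteq> \<Union>\<U> \<inter> D \<and> (D, p) \<in> F \<and> (D, q) \<in> F \<and>
        (\<forall>y\<in>W. q y \<noteq> 0 \<and> f y = p y / q y)"
      by (rule exI[of _ W], rule exI[of _ D], rule exI[of _ p], rule exI[of _ q]) (use * U in auto)
  qed
  \<comment> \<open>Where the numerator \<open>p\<close> is nonzero too, the inverse is
    \<open>q / p\<close>. The neighbourhood found here also shows that the nonvanishing locus is
    open.\<close>
  have inv: "\<exists>W D p q. openin ?T W \<and> x \<in> W \<and> W \<subseteq> {x \<in> U. f x \<noteq> 0} \<inter> D \<and> (D, p) \<in> F \<and>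
      (D, q) \<in> F \<and> (\<forall>y\<in>W. q y \<noteq> 0 \<and> inverse (f y) = p y / q y)"
    if f: "regular ?X U f" and x: "x \<in> {x \<in> U. f x \<noteq> 0}" for U f x
  proof -
    from x have "x \<in> U" by simp
    from regular_fraction_spaceE[OF f this] obtain W D p q where
      *: "openin ?T W" "x \<in> W" "W \<subseteq> U" "W \<subseteq> D" "(D, p) \<in> F" "(D, q) \<in> F"
      "\<And>y. y \<in> W \<Longrightarrow> q y \<noteq> 0" "\<And>y. y \<in> W \<Longrightarrow> f y = p y / q y" by metis
    show ?thesis
      by (rule exI[of _ "W \<inter> {x \<in> D. p x \<noteq> 0}"], rule exI[of _ D], rule exI[of _ q], rule exI[of _ p],
         use * x openin_fraction_space_basic[OF *(5)] in auto)
  qed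
  have inverse: "regular ?X {x \<in> U. f x \<noteq> 0} (\<lambda>x. inverse (f x))" if "regular ?X U f" for U f
    using inv[OF that] by (rule regular_fraction_spaceI)
  have nonzero: "openin ?T {x \<in> U. f x \<noteq> 0}" if "regular ?X U f" for U f
    by (subst openin_subopen) (use inv[OF that] in \<open>meson le_inf_iff\<close>)
  have union: "regular ?X (\<Union>\<U>) f \<longleftrightarrow> (\<forall>U\<in>\<U>. regular ?X U f)" if "\<forall>U\<in>\<U>. openin ?T U" for \<U> f
  proof (intro iffI ballI)
    fix U assume "regular ?X (\<Union>\<U>) f" "U \<in> \<U>"
    then show "regular ?X U f" using restrict that by metis
  qed (rule glue)
  show ?thesis
    unfolding space_with_functions_def
  proof (intro conjI)
    show "\<forall>U f g. openin ?T U \<and> (\<forall>x\<in>U. f x = g x) \<and> regular ?X U f \<longrightarrow> regular ?X U g"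
      by (intro allI impI, elim conjE) (rule cong)
    show "\<forall>U c. openin ?T U \<longrightarrow> regular ?X U (\<lambda>_. c)" by (intro allI impI const)
    show "\<forall>U f g. openin ?T U \<and> regular ?X U f \<and> regular ?X U g \<longrightarrow>
        regular ?X U (\<lambda>x. f x + g x) \<and> regular ?X U (\<lambda>x. f x * g x)"
      by (intro allI impI conjI add_mult) auto
    show "\<forall>\<U> f. (\<forall>U\<in>\<U>. openin ?T U) \<longrightarrow> regular ?X (\<Union>\<U>) f = (\<forall>U\<in>\<U>. regular ?X U f)"
      by (intro allI impI union)
    show "\<forall>U f. openin ?T U \<and> regular ?X U f \<longrightarrow>
        openin ?T {x \<in> U. f x \<noteq> 0} \<and> regular ?X {x \<in> U. f x \<noteq> 0} (\<lambda>x. inverse (f x))"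
      by (intro allI impI conjI nonzero inverse) auto
  qed
qed

end

text \<open>It is enough to test the members of \<open>F\<close>: generating open sets pull back to
  nonvanishing loci of regular functions, and local quotients pull back to local quotients.\<close>

lemma morphism_to_fraction_space:
  assumes X: "space_with_functions X"
    and points: "\<And>x. x \<in> points X \<Longrightarrow> \<phi> x \<in> points (fraction_space F)"
    and dom: "\<And>D f. (D, f) \<in> F \<Longrightarrow> openin (zariski X) {x \<in> points X. \<phi> x \<in> D}"
    and reg: "\<And>D f. (D, f) \<in> F \<Longrightarrow> regular X {x \<in> points X. \<phi> x \<in> D} (\<lambda>x. f (\<phi> x))"
  shows "morphism X (fraction_space F) \<phi>"
proof -
  have "continuous_map (zariski X) (topology_generated_by {{x \<in> D. f x \<noteq> 0} |D f. (D, f) \<in> F}) \<phi>"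
  proof (rule continuous_on_generated_topo)
    fix U assume "U \<in> {{x \<in> D. f x \<noteq> 0} |D f. (D, f) \<in> F}"
    then obtain D f where D: "(D, f) \<in> F" "U = {x \<in> D. f x \<noteq> 0}" by blast
    have "\<phi> -` U \<inter> points X = {x \<in> {x \<in> points X. \<phi> x \<in> D}. f (\<phi> x) \<noteq> 0}" by (auto simp: D)
    then show "openin (zariski X) (\<phi> -` U \<inter> points X)"
      using openin_nonvanishing[OF X dom[OF D(1)] reg[OF D(1)]] by simp
  next
    have "points (fraction_space F) = \<Union>{{x \<in> D. f x \<noteq> 0} |D f. (D, f) \<in> F}"
      by (simp add: fraction_space_def Let_def)
    then show "\<phi> ` points X \<subseteq> \<Union>{{x \<in> D. f x \<noteq> 0} |D f. (D, f) \<in> F}"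
      using points by (auto simp del: Union_iff)
  qed
  then have cont: "continuous_map (zariski X) (zariski (fraction_space F)) \<phi>"
    by (simp add: fraction_space_def Let_def)
  show ?thesis
  proof (rule morphismI[OF cont])
    fix V h assume V: "openin (zariski (fraction_space F)) V" "regular (fraction_space F) V h"
    show "regular X {x \<in> points X. \<phi> x \<in> V} (\<lambda>x. h (\<phi> x))"
    proof (rule regular_locally[OF X])
      fix x assume x: "x \<in> {x \<in> points X. \<phi> x \<in> V}"
      then have "\<phi> x \<in> V" by simp
      from regular_fraction_spaceE[OF V(2) this] obtain W D p q where
        W: "openin (zariski (fraction_space F)) W" "\<phi> x \<in> W" "W \<subseteq> V" "W \<subseteq> D"
        "(D, p) \<in> F" "(D, q) \<in> F" "\<And>y. y \<in> W \<Longrightarrow> q y \<noteq> 0" "\<And>y. y \<in> W \<Longrightarrow> h y = p y / q y" by metis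
      let ?U = "{x \<in> points X. \<phi> x \<in> W}"
      have U: "openin (zariski X) ?U" using openin_continuous_map_preimage[OF cont W(1)] .
      have p: "regular X ?U (\<lambda>x. p (\<phi> x))"
        by (rule regular_subset[OF X dom[OF W(5)] U _ reg[OF W(5)]]) (use W(4) in blast)
      have q: "regular X ?U (\<lambda>x. q (\<phi> x))"
        by (rule regular_subset[OF X dom[OF W(6)] U _ reg[OF W(6)]]) (use W(4) in blast)
      have "{x \<in> ?U. q (\<phi> x) \<noteq> 0} = ?U" using W(7) by auto
      then have "regular X ?U (\<lambda>x. inverse (q (\<phi> x)))" using regular_inverse[OF X U q] by simp
      from regular_mult[OF X U p this]
      have "regular X ?U (\<lambda>x. h (\<phi> x))"
        by (rule regular_cong[OF X U]) (use W(8) in \<open>auto simp: divide_inverse\<close>)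
      then show "\<exists>W. openin (zariski X) W \<and> x \<in> W \<and> W \<subseteq> {x \<in> points X. \<phi> x \<in> V} \<and>
          regular X W (\<lambda>x. h (\<phi> x))"
        by (intro exI[of _ ?U]) (use x W(2,3) U in auto)
    qed
  qed
qed

section \<open>Products and powers\<close>

definition prod_functions ::
  "('a, 'k::field) fun_space \<Rightarrow> ('b, 'k) fun_space \<Rightarrow> (('a \<times> 'b) set \<times> ('a \<times> 'b \<Rightarrow> 'k)) set" where
  "prod_functions X Y = {(U \<times> V, \<lambda>(x, y). \<Sum>j<m. g j x * h j y) |U V (m::nat) g h.
     openin (zariski X) U \<and> openin (zariski Y) V \<and>
     (\<forall>j<m. regular X U (g j) \<and> regular Y V (h j))}"

definition power_functions ::
  "nat \<Rightarrow> ('a, 'k::field) fun_space \<Rightarrow> ((nat \<Rightarrow> 'a) set \<times> ((nat \<Rightarrow> 'a) \<Rightarrow> 'k)) set" where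
  "power_functions n X = {(\<Pi>\<^sub>E i\<in>{..<n}. U i, \<lambda>x. \<Sum>j<m. \<Prod>i<n. g j i (x i)) |U (m::nat) g.
     (\<forall>i<n. openin (zariski X) (U i)) \<and> (\<forall>j<m. \<forall>i<n. regular X (U i) (g j i))}"

lemma prod_space_eq: "prod_space X Y = fraction_space (prod_functions X Y)"
  by (simp add: prod_space_def prod_functions_def)

lemma power_space_eq: "power_space n X = fraction_space (power_functions n X)"
  by (simp add: power_space_def power_functions_def)

text \<open>Arbitrary finite index sets are allowed so that sums and products of members can be
  indexed by disjoint sums and Cartesian products.\<close>

lemma prod_functionsI:
  assumes "finite J" "openin (zariski X) U" "openin (zariski Y) V"
    and "\<And>j. j \<in> J \<Longrightarrow> regular X U (g j)" "\<And>j. j \<in> J \<Longrightarrow> regular Y V (h j)"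
    and f: "f = (\<lambda>(x, y). \<Sum>j\<in>J. g j x * h j y)"
  shows "(U \<times> V, f) \<in> prod_functions X Y"
proof -
  obtain b where b: "bij_betw b {..<card J} J"
    using ex_bij_betw_nat_finite[OF assms(1)] by (auto simp: lessThan_atLeast0)
  have "f = (\<lambda>(x, y). \<Sum>i<card J. g (b i) x * h (b i) y)"
    unfolding f by (simp add: sum.reindex_bij_betw[OF b, of "\<lambda>j. g j _ * h j _"])
  moreover have "\<forall>i<card J. b i \<in> J" using b by (auto simp: bij_betw_def)
  ultimately show ?thesis
    unfolding prod_functions_def using assms(2-5)
    by (intro CollectI exI[of _ U] exI[of _ V] exI[of _ "card J"] exI[of _ "\<lambda>i. g (b i)"]
        exI[of _ "\<lambda>i. h (b i)"]) simp
qed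

lemma prod_functionsE:
  assumes "(D, f) \<in> prod_functions X Y"
  obtains U V m g h where "D = U \<times> V" "f = (\<lambda>(x, y). \<Sum>j<(m::nat). g j x * h j y)"
    "openin (zariski X) U" "openin (zariski Y) V"
    "\<And>j. j < m \<Longrightarrow> regular X U (g j)" "\<And>j. j < m \<Longrightarrow> regular Y V (h j)"
proof -
  from assms obtain U V m g h where *: "D = U \<times> V" "f = (\<lambda>(x, y). \<Sum>j<(m::nat). g j x * h j y)"
    "openin (zariski X) U" "openin (zariski Y) V" "\<forall>j<m. regular X U (g j) \<and> regular Y V (h j)"
    unfolding prod_functions_def by blast
  show thesis by (rule that[OF *(1-4)]) (use *(5) in auto)
qed

lemma fraction_family_prod_functions:
  assumes X: "space_with_functions X" and Y: "space_with_functions Y"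
  shows "fraction_family (prod_functions X Y)"
  unfolding fraction_family_def
proof (intro conjI allI impI; (elim conjE)?)
  fix D f c assume "(D, f) \<in> prod_functions X Y"
  then obtain U V where D: "D = U \<times> V" "openin (zariski X) U" "openin (zariski Y) V"
    by (elim prod_functionsE) (rule that)
  show "(D, \<lambda>_. c) \<in> prod_functions X Y"
    unfolding D(1)
    by (rule prod_functionsI[where J = "{()}" and g = "\<lambda>_ _. c" and h = "\<lambda>_ _. 1"])
      (use D regular_const[OF X] regular_const[OF Y] in auto)
next
  fix D f E g assume "(D, f) \<in> prod_functions X Y" and "(E, g) \<in> prod_functions X Y"
  from this(1) obtain U V m a b where D: "D = U \<times> V" "f = (\<lambda>(x, y). \<Sum>j<(m::nat). a j x * b j y)"
    "openin (zariski X) U" "openin (zariski Y) V"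
    "\<And>j. j < m \<Longrightarrow> regular X U (a j)" "\<And>j. j < m \<Longrightarrow> regular Y V (b j)"
    by (elim prod_functionsE) (rule that)
  from \<open>(E, g) \<in> prod_functions X Y\<close> obtain U' V' m' a' b' where
    E: "E = U' \<times> V'" "g = (\<lambda>(x, y). \<Sum>j<(m'::nat). a' j x * b' j y)"
    "openin (zariski X) U'" "openin (zariski Y) V'"
    "\<And>j. j < m' \<Longrightarrow> regular X U' (a' j)" "\<And>j. j < m' \<Longrightarrow> regular Y V' (b' j)"
    by (elim prod_functionsE) (rule that)
  have opn: "openin (zariski X) (U \<inter> U')" "openin (zariski Y) (V \<inter> V')" using D E by auto
  have reg: "regular X (U \<inter> U') (a j)" "regular Y (V \<inter> V') (b j)" if "j < m" for j
    using regular_subset[OF X D(3) opn(1) _ D(5)] regular_subset[OF Y D(4) opn(2) _ D(6)] that by auto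
  have reg': "regular X (U \<inter> U') (a' j)" "regular Y (V \<inter> V') (b' j)" if "j < m'" for j
    using regular_subset[OF X E(3) opn(1) _ E(5)] regular_subset[OF Y E(4) opn(2) _ E(6)] that by auto
  have DE: "D \<inter> E = (U \<inter> U') \<times> (V \<inter> V')" by (auto simp: D(1) E(1))
  show "(D \<inter> E, \<lambda>x. f x + g x) \<in> prod_functions X Y"
    unfolding DE
    by (rule prod_functionsI[where J = "{..<m} <+> {..<m'}" and g = "case_sum a a'" and h = "case_sum b b'"])
      (use opn reg reg' in \<open>auto simp: sum.Plus D(2) E(2)\<close>)
  show "(D \<inter> E, \<lambda>x. f x * g x) \<in> prod_functions X Y"
    unfolding DE
  proof (rule prod_functionsI)
    show "(\<lambda>x. f x * g x) = (\<lambda>(x, y). \<Sum>p\<in>{..<m} \<times> {..<m'}.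
        (a (fst p) x * a' (snd p) x) * (b (fst p) y * b' (snd p) y))"
      unfolding D(2) E(2) fun_eq_iff
      by (simp add: sum_product sum.cartesian_product case_prod_beta) (simp add: mult_ac)
  qed (use opn reg reg' regular_mult[OF X opn(1)] regular_mult[OF Y opn(2)] in auto)
qed

lemma power_functionsI:
  assumes "finite J" "\<And>i. i < n \<Longrightarrow> openin (zariski X) (U i)"
    and "\<And>j i. j \<in> J \<Longrightarrow> i < n \<Longrightarrow> regular X (U i) (g j i)"
    and f: "f = (\<lambda>x. \<Sum>j\<in>J. \<Prod>i<n. g j i (x i))"
  shows "(\<Pi>\<^sub>E i\<in>{..<n}. U i, f) \<in> power_functions n X"
proof -
  obtain b where b: "bij_betw b {..<card J} J"
    using ex_bij_betw_nat_finite[OF assms(1)] by (auto simp: lessThan_atLeast0)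
  have "f = (\<lambda>x. \<Sum>k<card J. \<Prod>i<n. g (b k) i (x i))"
    unfolding f by (simp add: sum.reindex_bij_betw[OF b, of "\<lambda>j. \<Prod>i<n. g j i (_ i)"])
  moreover have "\<forall>k<card J. b k \<in> J" using b by (auto simp: bij_betw_def)
  ultimately show ?thesis
    unfolding power_functions_def using assms(2,3)
    by (intro CollectI exI[of _ U] exI[of _ "card J"] exI[of _ "\<lambda>k. g (b k)"]) simp
qed

lemma power_functionsE:
  assumes "(D, f) \<in> power_functions n X"
  obtains U m g where "D = (\<Pi>\<^sub>E i\<in>{..<n}. U i)" "f = (\<lambda>x. \<Sum>j<(m::nat). \<Prod>i<n. g j i (x i))"
    "\<And>i. i < n \<Longrightarrow> openin (zariski X) (U i)" "\<And>j i. j < m \<Longrightarrow> i < n \<Longrightarrow> regular X (U i) (g j i)"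
proof -
  from assms obtain U m g where *: "D = (\<Pi>\<^sub>E i\<in>{..<n}. U i)"
    "f = (\<lambda>x. \<Sum>j<(m::nat). \<Prod>i<n. g j i (x i))"
    "\<forall>i<n. openin (zariski X) (U i)" "\<forall>j<m. \<forall>i<n. regular X (U i) (g j i)"
    unfolding power_functions_def by blast
  show thesis by (rule that[OF *(1,2)]) (use *(3,4) in auto)
qed

text \<open>For \<open>n = 0\<close> the members are the constants \<open>of_nat m\<close> only.\<close>

lemma fraction_family_power_functions:
  assumes X: "space_with_functions X" and n: "n > 0"
  shows "fraction_family (power_functions n X)"
  unfolding fraction_family_def
proof (intro conjI allI impI; (elim conjE)?)
  fix D f c assume "(D, f) \<in> power_functions n X"
  then obtain U where D: "D = (\<Pi>\<^sub>E i\<in>{..<n}. U i)" "\<And>i. i < n \<Longrightarrow> openin (zariski X) (U i)"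
    by (elim power_functionsE) (rule that)
  show "(D, \<lambda>_. c) \<in> power_functions n X"
    unfolding D(1)
    by (rule power_functionsI[where J = "{()}" and g = "\<lambda>_ i _. if i = 0 then c else 1"])
      (use D regular_const[OF X] n in \<open>auto simp: prod.remove[of _ 0]\<close>)
next
  fix D f E g assume "(D, f) \<in> power_functions n X" and "(E, g) \<in> power_functions n X"
  from this(1) obtain U m a where D: "D = (\<Pi>\<^sub>E i\<in>{..<n}. U i)"
    "f = (\<lambda>x. \<Sum>j<(m::nat). \<Prod>i<n. a j i (x i))"
    "\<And>i. i < n \<Longrightarrow> openin (zariski X) (U i)" "\<And>j i. j < m \<Longrightarrow> i < n \<Longrightarrow> regular X (U i) (a j i)"
    by (elim power_functionsE) (rule that)
  from \<open>(E, g) \<in> power_functions n X\<close> obtain U' m' a' where E: "E = (\<Pi>\<^sub>E i\<in>{..<n}. U' i)"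
    "g = (\<lambda>x. \<Sum>j<(m'::nat). \<Prod>i<n. a' j i (x i))"
    "\<And>i. i < n \<Longrightarrow> openin (zariski X) (U' i)" "\<And>j i. j < m' \<Longrightarrow> i < n \<Longrightarrow> regular X (U' i) (a' j i)"
    by (elim power_functionsE) (rule that)
  have opn: "openin (zariski X) (U i \<inter> U' i)" if "i < n" for i using D E that by auto
  have reg: "regular X (U i \<inter> U' i) (a j i)" if "j < m" "i < n" for i j
    using regular_subset[OF X D(3) opn _ D(4)] that by auto
  have reg': "regular X (U i \<inter> U' i) (a' j i)" if "j < m'" "i < n" for i j
    using regular_subset[OF X E(3) opn _ E(4)] that by auto
  have DE: "D \<inter> E = (\<Pi>\<^sub>E i\<in>{..<n}. U i \<inter> U' i)" by (auto simp: D(1) E(1) PiE_Int)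
  show "(D \<inter> E, \<lambda>x. f x + g x) \<in> power_functions n X"
    unfolding DE
    by (rule power_functionsI[where J = "{..<m} <+> {..<m'}" and g = "case_sum a a'"])
      (use opn reg reg' in \<open>auto simp: sum.Plus D(2) E(2)\<close>)
  show "(D \<inter> E, \<lambda>x. f x * g x) \<in> power_functions n X"
    unfolding DE
  proof (rule power_functionsI)
    show "(\<lambda>x. f x * g x) = (\<lambda>x. \<Sum>p\<in>{..<m} \<times> {..<m'}. \<Prod>i<n. a (fst p) i (x i) * a' (snd p) i (x i))"
      by (simp add: fun_eq_iff D(2) E(2) sum_product sum.cartesian_product case_prod_beta prod.distrib)
  qed (use opn reg reg' regular_mult[OF X opn] in auto)
qed

lemmas space_with_functions_power_space =
  space_with_functions_fraction_space[OF fraction_family_power_functions, folded power_space_eq]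

lemma fraction_space_domain_subset: "(D, \<lambda>_. 1) \<in> F \<Longrightarrow> D \<subseteq> points (fraction_space F)"
  using openin_subset[OF openin_fraction_space_basic[of D "\<lambda>_. 1" F]] by simp

lemma points_prod_space:
  assumes X: "space_with_functions X" and Y: "space_with_functions Y"
  shows "points (prod_space X Y) = points X \<times> points Y"
proof
  have "(points X \<times> points Y, \<lambda>_. 1) \<in> prod_functions X Y"
    by (rule prod_functionsI[where J = "{()}" and g = "\<lambda>_ _. 1" and h = "\<lambda>_ _. 1"])
      (use regular_const[OF X] regular_const[OF Y] in auto)
  then show "points X \<times> points Y \<subseteq> points (prod_space X Y)"
    unfolding prod_space_eq by (rule fraction_space_domain_subset)
  show "points (prod_space X Y) \<subseteq> points X \<times> points Y"
  proof
    fix z assume "z \<in> points (prod_space X Y)"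
    then obtain D f where "(D, f) \<in> prod_functions X Y" "z \<in> D"
      by (auto simp: prod_space_eq points_fraction_space)
    then obtain U V where "z \<in> U \<times> V" "openin (zariski X) U" "openin (zariski Y) V"
      by (elim prod_functionsE) (rule that, simp_all)
    then show "z \<in> points X \<times> points Y" by (auto dest: openin_subset)
  qed
qed

lemma points_power_space:
  assumes X: "space_with_functions X"
  shows "points (power_space n X) = (\<Pi>\<^sub>E i\<in>{..<n}. points X)"
proof
  have "((\<Pi>\<^sub>E i\<in>{..<n}. points X), \<lambda>_. 1) \<in> power_functions n X"
    by (rule power_functionsI[where J = "{()}" and g = "\<lambda>_ _ _. 1"])
      (use regular_const[OF X] in auto)
  then show "(\<Pi>\<^sub>E i\<in>{..<n}. points X) \<subseteq> points (power_space n X)"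
    unfolding power_space_eq by (rule fraction_space_domain_subset)
  show "points (power_space n X) \<subseteq> (\<Pi>\<^sub>E i\<in>{..<n}. points X)"
  proof
    fix x assume "x \<in> points (power_space n X)"
    then obtain D f where "(D, f) \<in> power_functions n X" "x \<in> D"
      by (auto simp: power_space_eq points_fraction_space)
    then obtain U where "x \<in> (\<Pi>\<^sub>E i\<in>{..<n}. U i)" "\<And>i. i < n \<Longrightarrow> openin (zariski X) (U i)"
      by (elim power_functionsE) (rule that, simp_all)
    then show "x \<in> (\<Pi>\<^sub>E i\<in>{..<n}. points X)" by (auto simp: PiE_iff dest: openin_subset)
  qed
qed

lemma morphism_Pair:
  assumes Q: "space_with_functions Q" and X: "space_with_functions X" and Y: "space_with_functions Y"
    and \<alpha>: "morphism Q X \<alpha>" and \<beta>: "morphism Q Y \<beta>"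
  shows "morphism Q (prod_space X Y) (\<lambda>q. (\<alpha> q, \<beta> q))"
  unfolding prod_space_eq
proof (rule morphism_to_fraction_space[OF Q])
  fix q assume "q \<in> points Q"
  then show "(\<alpha> q, \<beta> q) \<in> points (fraction_space (prod_functions X Y))"
    using morphism_in_points[OF \<alpha>] morphism_in_points[OF \<beta>]
    by (simp add: points_prod_space[OF X Y] flip: prod_space_eq)
next
  fix D f assume "(D, f) \<in> prod_functions X Y"
  then obtain U V m g h where D: "D = U \<times> V" "f = (\<lambda>(x, y). \<Sum>j<(m::nat). g j x * h j y)"
    "openin (zariski X) U" "openin (zariski Y) V"
    "\<And>j. j < m \<Longrightarrow> regular X U (g j)" "\<And>j. j < m \<Longrightarrow> regular Y V (h j)" by (elim prod_functionsE) (rule that)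
  let ?U = "{q \<in> points Q. \<alpha> q \<in> U}" and ?V = "{q \<in> points Q. \<beta> q \<in> V}"
  have eq: "{q \<in> points Q. (\<alpha> q, \<beta> q) \<in> D} = ?U \<inter> ?V" by (auto simp: D(1))
  have U: "openin (zariski Q) ?U" and V: "openin (zariski Q) ?V"
    using morphism_openin_vimage[OF \<alpha> D(3)] morphism_openin_vimage[OF \<beta> D(4)] .
  then have UV: "openin (zariski Q) (?U \<inter> ?V)" by blast
  show "openin (zariski Q) {q \<in> points Q. (\<alpha> q, \<beta> q) \<in> D}" unfolding eq by (rule UV)
  have "regular Q (?U \<inter> ?V) (\<lambda>q. \<Sum>j<m. g j (\<alpha> q) * h j (\<beta> q))"
  proof (rule regular_sum[OF Q _ UV regular_mult[OF Q UV]])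
    fix j assume "j \<in> {..<m}"
    then have "j < m" by simp
    show "regular Q (?U \<inter> ?V) (\<lambda>q. g j (\<alpha> q))"
      by (rule regular_subset[OF Q U UV _ morphism_regular[OF \<alpha> D(3) D(5)[OF \<open>j < m\<close>]]]) blast
    show "regular Q (?U \<inter> ?V) (\<lambda>q. h j (\<beta> q))"
      by (rule regular_subset[OF Q V UV _ morphism_regular[OF \<beta> D(4) D(6)[OF \<open>j < m\<close>]]]) blast
  qed simp
  then show "regular Q {q \<in> points Q. (\<alpha> q, \<beta> q) \<in> D} (\<lambda>q. f (\<alpha> q, \<beta> q))"
    by (simp add: eq D(2))
qed

lemma openin_vimage_coordinates:
  fixes n :: nat
  assumes "\<And>i. i < n \<Longrightarrow> morphism Q X (\<lambda>q. \<phi> q i)" "\<And>i. i < n \<Longrightarrow> openin (zariski X) (U i)"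
  shows "openin (zariski Q) {q \<in> points Q. \<forall>i<n. \<phi> q i \<in> U i}"
  using assms
proof (induction n)
  case (Suc n)
  have "{q \<in> points Q. \<forall>i<Suc n. \<phi> q i \<in> U i} =
    {q \<in> points Q. \<forall>i<n. \<phi> q i \<in> U i} \<inter> {q \<in> points Q. \<phi> q n \<in> U n}"
    by (auto simp: less_Suc_eq)
  then show ?case
    using Suc.IH Suc.prems morphism_openin_vimage[OF Suc.prems(1)[of n] Suc.prems(2)[of n]] by auto
qed simp

lemma morphism_to_power_space:
  assumes Q: "space_with_functions Q" and X: "space_with_functions X"
    and \<phi>: "\<And>i. i < n \<Longrightarrow> morphism Q X (\<lambda>q. \<phi> q i)"
    and ext: "\<And>q. q \<in> points Q \<Longrightarrow> \<phi> q \<in> extensional {..<n}"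
  shows "morphism Q (power_space n X) \<phi>"
  unfolding power_space_eq
proof (rule morphism_to_fraction_space[OF Q])
  fix q assume "q \<in> points Q"
  then show "\<phi> q \<in> points (fraction_space (power_functions n X))"
    using morphism_in_points[OF \<phi>] ext
    by (simp add: points_power_space[OF X] PiE_iff flip: power_space_eq)
next
  fix D f assume "(D, f) \<in> power_functions n X"
  then obtain U m g where D: "D = (\<Pi>\<^sub>E i\<in>{..<n}. U i)"
    "f = (\<lambda>x. \<Sum>j<(m::nat). \<Prod>i<n. g j i (x i))"
    "\<And>i. i < n \<Longrightarrow> openin (zariski X) (U i)" "\<And>j i. j < m \<Longrightarrow> i < n \<Longrightarrow> regular X (U i) (g j i)"
    by (elim power_functionsE) (rule that)
  let ?W = "{q \<in> points Q. \<forall>i<n. \<phi> q i \<in> U i}"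
  have eq: "{q \<in> points Q. \<phi> q \<in> D} = ?W" using ext by (auto simp: D(1) PiE_iff)
  have W: "openin (zariski Q) ?W" by (rule openin_vimage_coordinates[OF \<phi> D(3)])
  then show "openin (zariski Q) {q \<in> points Q. \<phi> q \<in> D}" by (simp add: eq)
  have "regular Q ?W (\<lambda>q. \<Sum>j<m. \<Prod>i<n. g j i (\<phi> q i))"
  proof (rule regular_sum[OF Q _ W], simp, rule regular_prod[OF Q _ W], simp)
    fix j i assume "j \<in> {..<m}" "i \<in> {..<n}"
    then have *: "j < m" "i < n" by simp_all
    show "regular Q ?W (\<lambda>q. g j i (\<phi> q i))"
      by (rule regular_subset[OF Q morphism_openin_vimage[OF \<phi> D(3)] W _
            morphism_regular[OF \<phi> D(3) D(4)]]) (use * in auto)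
  qed
  then show "regular Q {q \<in> points Q. \<phi> q \<in> D} (\<lambda>q. f (\<phi> q))" by (simp add: eq D(2))
qed

lemma morphism_coordinate:
  assumes X: "space_with_functions X" and i: "i < n"
  shows "morphism (power_space n X) X (\<lambda>x. x i)"
proof (rule morphismI)
  have n: "n > 0" using i by simp
  \<comment> \<open>A function of the single coordinate \<open>i\<close> is a one-term member, with
    constant factors 1 in all other coordinates.\<close>
  have family: "(\<Pi>\<^sub>E k\<in>{..<n}. if k = i then U else points X, \<lambda>x. f (x i)) \<in> power_functions n X"
    if "openin (zariski X) U" "regular X U f" for U f
    by (rule power_functionsI[where J = "{()}" and g = "\<lambda>_ k. if k = i then f else (\<lambda>_. 1)"])
      (use that i regular_const[OF X] in \<open>auto simp: prod.remove[of _ i]\<close>)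
  have eq: "{x \<in> points (power_space n X). x i \<in> U} = (\<Pi>\<^sub>E k\<in>{..<n}. if k = i then U else points X)"
    if "openin (zariski X) U" for U
  proof (intro equalityI subsetI)
    fix x assume x: "x \<in> (\<Pi>\<^sub>E k\<in>{..<n}. if k = i then U else points X)"
    then have *: "\<forall>k<n. x k \<in> (if k = i then U else points X)" by (simp add: PiE_iff)
    then have "x i \<in> U" using i by auto
    moreover from * have "\<forall>k<n. x k \<in> points X" using openin_subset[OF that] by (metis subsetD)
    ultimately show "x \<in> {x \<in> points (power_space n X). x i \<in> U}"
      using x by (simp add: points_power_space[OF X] PiE_iff)
  qed (simp add: points_power_space[OF X] PiE_iff)
  have opn: "openin (zariski (power_space n X)) {x \<in> points (power_space n X). x i \<in> U}"
    if "openin (zariski X) U" for U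
    unfolding eq[OF that]
    using openin_fraction_space_domain[OF fraction_family_power_functions[OF X n]
        family[OF that regular_const[OF X that]]] by (simp add: power_space_eq)
  show "continuous_map (zariski (power_space n X)) (zariski X) (\<lambda>x. x i)"
    unfolding continuous_map_def using opn i by (auto simp: points_power_space[OF X])
  fix U f assume U: "openin (zariski X) U" "regular X U f"
  show "regular (power_space n X) {x \<in> points (power_space n X). x i \<in> U} (\<lambda>x. f (x i))"
    unfolding eq[OF U(1)]
    using regular_fraction_space_member[OF fraction_family_power_functions[OF X n] family[OF U]]
    by (simp add: power_space_eq)
qed

text \<open>\<open>S\<close> consists of the coordinate functions of an embedding of
  \<open>Y\<close> into affine space. If they pull back to regular functions, so do all polynomials
  in them, and composing with the inverse of the embedding recovers \<open>\<phi>\<close>. This form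
  hides the embedding and keeps only a finite test set.\<close>

lemma affine_variety_coordinates:
  fixes Y :: "('y, 'k::field) fun_space"
  assumes "affine_variety Y"
  shows "\<exists>S::('y \<Rightarrow> 'k) set. finite S \<and> (\<forall>(Q::('q, 'k) fun_space) \<phi>. space_with_functions Q \<longrightarrow>
    (\<forall>q\<in>points Q. \<phi> q \<in> points Y) \<longrightarrow> (\<forall>s\<in>S. regular Q (points Q) (\<lambda>q. s (\<phi> q))) \<longrightarrow>
    morphism Q Y \<phi>)"
proof -
  obtain n Z \<alpha> \<beta> where \<alpha>: "morphism Y (induced_space (affine_space n) Z) \<alpha>"
    and \<beta>: "morphism (induced_space (affine_space n) Z) Y \<beta>"
    and inv: "\<forall>y\<in>points Y. \<beta> (\<alpha> y) = y"
    using assms unfolding affine_variety_def isomorphic_def by blast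
  show ?thesis
  proof (intro exI[of _ "(\<lambda>i y. \<alpha> y i) ` {..<n}"] conjI allI impI)
    fix Q :: "('q, 'k) fun_space" and \<phi>
    assume Q: "space_with_functions Q" and \<phi>: "\<forall>q\<in>points Q. \<phi> q \<in> points Y"
      and reg: "\<forall>s\<in>(\<lambda>i y. \<alpha> y i) ` {..<n}. regular Q (points Q) (\<lambda>q. s (\<phi> q))"
    have in_Z: "\<alpha> (\<phi> q) \<in> points (affine_space n) \<inter> Z" if "q \<in> points Q" for q
      using morphism_in_points[OF \<alpha>] \<phi> that by (simp add: points_induced_space)
    have "morphism Q (affine_space n) (\<lambda>q. \<alpha> (\<phi> q))"
      unfolding affine_space_def
    proof (rule morphism_to_fraction_space[OF Q])
      fix q assume "q \<in> points Q"
      then show "\<alpha> (\<phi> q) \<in> points (fraction_space {({..<n} \<rightarrow>\<^sub>E UNIV, p) |p. p \<in> polynomial_functions n})"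
        using in_Z by (simp add: affine_space_def)
    next
      fix D :: "(nat \<Rightarrow> 'k) set" and p :: "(nat \<Rightarrow> 'k) \<Rightarrow> 'k"
      assume "(D, p) \<in> {({..<n} \<rightarrow>\<^sub>E UNIV, p) |p. p \<in> polynomial_functions n}"
      then have D: "D = {..<n} \<rightarrow>\<^sub>E UNIV" and p: "p \<in> polynomial_functions n" by auto
      have "points (affine_space n :: (nat \<Rightarrow> 'k, 'k) fun_space) \<subseteq> {..<n} \<rightarrow>\<^sub>E UNIV"
        by (auto simp: affine_space_def points_fraction_space)
      then have eq: "{q \<in> points Q. \<alpha> (\<phi> q) \<in> D} = points Q" using in_Z D by blast
      show "openin (zariski Q) {q \<in> points Q. \<alpha> (\<phi> q) \<in> D}" unfolding eq by simp
      show "regular Q {q \<in> points Q. \<alpha> (\<phi> q) \<in> D} (\<lambda>q. p (\<alpha> (\<phi> q)))"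
        unfolding eq using p
        by induction (use reg regular_const[OF Q] regular_add[OF Q] regular_mult[OF Q] in auto)
    qed
    from morphism_to_induced_space[OF Q this] have
      "morphism Q (induced_space (affine_space n) Z) (\<lambda>q. \<alpha> (\<phi> q))" using in_Z by blast
    from morphism_comp[OF this \<beta>] show "morphism Q Y \<phi>"
      by (rule morphism_cong[OF Q]) (use inv \<phi> in auto)
  qed simp
qed

section \<open>Noetherian topologies\<close>

text \<open>Compactness of all open sets, which is equivalent to the ascending chain condition on
  open sets.\<close>

definition noetherian_topology :: "'a topology \<Rightarrow> bool" where
  "noetherian_topology T \<longleftrightarrow>
    (\<forall>\<D>. (\<forall>D\<in>\<D>. openin T D) \<longrightarrow> (\<exists>\<E>\<subseteq>\<D>. finite \<E> \<and> \<Union>\<E> = \<Union>\<D>))"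

lemma ideal_span_vanishing:
  fixes P :: "('x \<Rightarrow> 'k::comm_ring_1) set"
  assumes "p \<in> ideal_span R P" "\<And>f. f \<in> P \<Longrightarrow> f x = 0"
  shows "p x = 0"
  using assms by induction simp_all

lemma fraction_family_subring:
  assumes "is_subring R" "range (\<lambda>c _. c) \<subseteq> R"
  shows "fraction_family {(A, p) |p. p \<in> R}"
proof -
  have "(\<lambda>x. p x + q x) \<in> R \<and> (\<lambda>x. p x * q x) \<in> R" if "p \<in> R" "q \<in> R" for p q
    using assms(1) that unfolding is_subring_def plus_fun_def times_fun_def by blast
  then show ?thesis
    unfolding fraction_family_def using assms(2) by (auto simp: image_subset_iff)
qed

text \<open>Let \<open>P\<close> be the functions in \<open>R\<close> whose nonvanishing locus on
  \<open>A\<close> lies in a member of the cover. Finitely many generators taken from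
  \<open>P\<close> have the same common zeros as \<open>P\<close>, so their loci cover the same set,
  and each one picks a member of the cover.\<close>

lemma noetherian_fraction_space:
  fixes R :: "('x \<Rightarrow> 'k::field) set"
  assumes R: "noetherian_subring R" "range (\<lambda>c _. c) \<subseteq> R"
  shows "noetherian_topology (zariski (fraction_space {(A, p) |p. p \<in> R}))"
  unfolding noetherian_topology_def
proof (intro allI impI)
  let ?X = "fraction_space {(A, p) |p. p \<in> R}"
  have "is_subring R" using R(1) by (simp add: noetherian_subring_def)
  then have family: "fraction_family {(A, p) |p. p \<in> R}" using R(2) by (rule fraction_family_subring)
  fix \<D> assume \<D>: "\<forall>D\<in>\<D>. openin (zariski ?X) D"
  define P where "P = {p \<in> R. \<exists>D\<in>\<D>. {x \<in> A. p x \<noteq> 0} \<subseteq> D}"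
  have "P \<subseteq> R" by (auto simp: P_def)
  then obtain F where F: "F \<subseteq> P" "finite F" "P \<subseteq> ideal_span R F"
    using R(1) unfolding noetherian_subring_def by blast
  have "\<forall>p\<in>F. \<exists>D. D \<in> \<D> \<and> {x \<in> A. p x \<noteq> 0} \<subseteq> D" using F(1) by (auto simp: P_def)
  then obtain d where d: "\<And>p. p \<in> F \<Longrightarrow> d p \<in> \<D>" "\<And>p. p \<in> F \<Longrightarrow> {x \<in> A. p x \<noteq> 0} \<subseteq> d p" by metis
  have "x \<in> \<Union>(d ` F)" if x: "D \<in> \<D>" "x \<in> D" for D x
  proof -
    obtain p where p: "p \<in> R" "x \<in> A" "p x \<noteq> 0" "{y \<in> A. p y \<noteq> 0} \<subseteq> D"
      using fraction_space_base[OF family bspec[OF \<D> x(1)] x(2)] by auto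
    then have "p \<in> ideal_span R F" using F(3) x(1) by (auto simp: P_def)
    then obtain f where "f \<in> F" "f x \<noteq> 0" using ideal_span_vanishing p(3) by metis
    then show ?thesis using d(2) p(2) by blast
  qed
  then have "\<Union>(d ` F) = \<Union>\<D>" using d(1) by blast
  then show "\<exists>\<E>\<subseteq>\<D>. finite \<E> \<and> \<Union>\<E> = \<Union>\<D>" using d(1) F(2) by (intro exI[of _ "d ` F"]) auto
qed

text \<open>The topologies on the pieces may be finer than the subspace topologies, so only one
  direction of comparison has to be checked when the lemma is applied.\<close>

lemma noetherian_topology_cover:
  assumes "finite \<T>" "topspace T \<subseteq> (\<Union>S\<in>\<T>. topspace S)"
    and noeth: "\<And>S. S \<in> \<T> \<Longrightarrow> noetherian_topology S"
    and coarser: "\<And>S D. S \<in> \<T> \<Longrightarrow> openin T D \<Longrightarrow> openin S (topspace S \<inter> D)"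
  shows "noetherian_topology T"
  unfolding noetherian_topology_def
proof (intro allI impI)
  fix \<D> assume \<D>: "\<forall>D\<in>\<D>. openin T D"
  have "\<forall>S\<in>\<T>. \<exists>\<E>. \<E> \<subseteq> \<D> \<and> finite \<E> \<and> topspace S \<inter> \<Union>\<D> \<subseteq> \<Union>\<E>"
  proof
    fix S assume S: "S \<in> \<T>"
    have "\<forall>D\<in>(\<inter>) (topspace S) ` \<D>. openin S D" using coarser[OF S] \<D> by blast
    from noeth[OF S, unfolded noetherian_topology_def, THEN spec, THEN mp, OF this]
    obtain \<E> where \<E>: "\<E> \<subseteq> (\<inter>) (topspace S) ` \<D>" "finite \<E>"
      "\<Union>\<E> = \<Union>((\<inter>) (topspace S) ` \<D>)" by (elim exE conjE)
    from finite_subset_image[OF \<E>(2,1)] obtain \<D>' where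
      "\<D>' \<subseteq> \<D>" "finite \<D>'" "\<E> = (\<inter>) (topspace S) ` \<D>'" by blast
    then show "\<exists>\<E>. \<E> \<subseteq> \<D> \<and> finite \<E> \<and> topspace S \<inter> \<Union>\<D> \<subseteq> \<Union>\<E>"
      using \<E>(3) by (intro exI[of _ \<D>'] conjI) blast+
  qed
  then obtain e where e: "\<And>S. S \<in> \<T> \<Longrightarrow> e S \<subseteq> \<D>" "\<And>S. S \<in> \<T> \<Longrightarrow> finite (e S)"
    "\<And>S. S \<in> \<T> \<Longrightarrow> topspace S \<inter> \<Union>\<D> \<subseteq> \<Union>(e S)" by metis
  have "\<Union>\<D> \<subseteq> \<Union>(\<Union>S\<in>\<T>. e S)"
  proof
    fix x assume x: "x \<in> \<Union>\<D>"
    then have "x \<in> topspace T" using \<D> openin_subset by fastforce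
    then obtain S where "S \<in> \<T>" "x \<in> topspace S" using assms(2) by blast
    then show "x \<in> \<Union>(\<Union>S\<in>\<T>. e S)" using e(3)[of S] x by blast
  qed
  moreover have sub: "(\<Union>S\<in>\<T>. e S) \<subseteq> \<D>" using e(1) by blast
  ultimately have "\<Union>(\<Union>S\<in>\<T>. e S) = \<Union>\<D>" by (meson Union_mono subset_antisym)
  moreover have "finite (\<Union>S\<in>\<T>. e S)" using e(2) assms(1) by blast
  ultimately show "\<exists>\<E>\<subseteq>\<D>. finite \<E> \<and> \<Union>\<E> = \<Union>\<D>" using sub by meson
qed

lemma variety_space_with_functions: "variety X \<Longrightarrow> space_with_functions X"
  by (simp add: variety_def)

text \<open>The product is covered by finitely many boxes of affine open sets. On each box, a
  noetherian ring containing the coordinate functions of all factors defines a space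
  \<open>Q\<close>; the universal properties make the identity a morphism from \<open>Q\<close> to
  the product, so the topology of \<open>Q\<close> refines the Zariski topology on the box.\<close>

lemma noetherian_prod_power_space:
  fixes X :: "('a, 'k::field) fun_space" and Y :: "('b, 'k) fun_space"
  assumes X: "variety X" and Y: "variety Y" and n: "n > 0"
  shows "noetherian_topology (zariski (prod_space (power_space n X) Y))" (is "noetherian_topology ?T")
proof -
  note sX = variety_space_with_functions[OF X] and sY = variety_space_with_functions[OF Y]
  note sXn = space_with_functions_power_space[OF sX n]
  obtain \<U> where \<U>: "finite \<U>" "\<Union>\<U> = points X"
    "\<And>U. U \<in> \<U> \<Longrightarrow> affine_variety (induced_space X U)"
    using X unfolding variety_def by (elim conjE exE) metis
  obtain \<W> where \<W>: "finite \<W>" "\<Union>\<W> = points Y"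
    "\<And>W. W \<in> \<W> \<Longrightarrow> affine_variety (induced_space Y W)"
    using Y unfolding variety_def by (elim conjE exE) metis
  have "\<exists>S. topspace S = (\<Pi>\<^sub>E i\<in>{..<n}. u i) \<times> W \<and> noetherian_topology S \<and>
      (\<forall>D. openin ?T D \<longrightarrow> openin S (topspace S \<inter> D))"
    if u: "u \<in> {..<n} \<rightarrow>\<^sub>E \<U>" and W: "W \<in> \<W>" for u W
  proof -
    define A where "A = (\<Pi>\<^sub>E i\<in>{..<n}. u i) \<times> W"
    have ui: "u i \<in> \<U>" if "i < n" for i using u that by auto
    have "\<forall>i\<in>{..<n}. \<exists>S::('a \<Rightarrow> 'k) set. finite S \<and>
      (\<forall>(Q::((nat \<Rightarrow> 'a) \<times> 'b, 'k) fun_space) \<phi>. space_with_functions Q \<longrightarrow>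
        (\<forall>q\<in>points Q. \<phi> q \<in> points (induced_space X (u i))) \<longrightarrow>
        (\<forall>s\<in>S. regular Q (points Q) (\<lambda>q. s (\<phi> q))) \<longrightarrow> morphism Q (induced_space X (u i)) \<phi>)"
      using affine_variety_coordinates[OF \<U>(3)[OF ui]] by blast
    from bchoice[OF this] obtain S where S: "\<forall>i\<in>{..<n}. finite (S i) \<and>
      (\<forall>(Q::((nat \<Rightarrow> 'a) \<times> 'b, 'k) fun_space) \<phi>. space_with_functions Q \<longrightarrow>
        (\<forall>q\<in>points Q. \<phi> q \<in> points (induced_space X (u i))) \<longrightarrow>
        (\<forall>s\<in>S i. regular Q (points Q) (\<lambda>q. s (\<phi> q))) \<longrightarrow> morphism Q (induced_space X (u i)) \<phi>)"
      by (elim exE) (rule that)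
    have S_morphism: "morphism Q (induced_space X (u i)) \<phi>"
      if "i < n" "space_with_functions Q" "\<And>q. q \<in> points Q \<Longrightarrow> \<phi> q \<in> points (induced_space X (u i))"
        "\<And>s. s \<in> S i \<Longrightarrow> regular Q (points Q) (\<lambda>q. s (\<phi> q))"
      for i \<phi> and Q :: "((nat \<Rightarrow> 'a) \<times> 'b, 'k) fun_space"
      using S that by simp
    obtain S' where S': "finite S'"
      "\<forall>(Q::((nat \<Rightarrow> 'a) \<times> 'b, 'k) fun_space) \<phi>. space_with_functions Q \<longrightarrow>
        (\<forall>q\<in>points Q. \<phi> q \<in> points (induced_space Y W)) \<longrightarrow>
        (\<forall>s\<in>S'. regular Q (points Q) (\<lambda>q. s (\<phi> q))) \<longrightarrow> morphism Q (induced_space Y W) \<phi>"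
      using affine_variety_coordinates[OF \<W>(3)[OF W]] by (elim exE conjE) (rule that)
    \<comment> \<open>The affine coordinates of all \<open>n + 1\<close> factors, pulled back to the
      box. Adjoining these finitely many functions to the constants keeps the ring
      noetherian.\<close>
    define C where "C = (\<Union>i<n. (\<lambda>s q. s (fst q i)) ` S i) \<union> (\<lambda>s q. s (snd q)) ` S'"
    have "finite C" using S S'(1) by (simp add: C_def)
    from noetherian_subring_extend[OF this noetherian_subring_constants] obtain R where
      R: "noetherian_subring R" "range (\<lambda>c _. c) \<subseteq> R" "C \<subseteq> R" by blast
    have family: "fraction_family {(A, p) |p. p \<in> R}"
      by (rule fraction_family_subring) (use R in \<open>auto simp: noetherian_subring_def\<close>)
    define Q where "Q = fraction_space {(A, p) |p. p \<in> R}"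
    have Q: "space_with_functions Q"
      unfolding Q_def by (rule space_with_functions_fraction_space[OF family])
    have "A \<subseteq> points Q" unfolding Q_def by (rule fraction_space_domain_subset) (use R(2) in auto)
    moreover have "points Q \<subseteq> A" by (auto simp: Q_def points_fraction_space)
    ultimately have points_Q: "points Q = A" by blast
    have reg: "regular Q (points Q) p" if "p \<in> R" for p
      unfolding points_Q unfolding Q_def
      by (rule regular_fraction_space_member[OF family]) (use that in simp)
    have fst: "morphism Q (power_space n X) fst"
    proof (rule morphism_to_power_space[OF Q sX])
      fix i assume i: "i < n"
      have "morphism Q (induced_space X (u i)) (\<lambda>q. fst q i)"
      proof (rule S_morphism[OF i Q])
        fix q assume "q \<in> points Q"
        then have "fst q \<in> (\<Pi>\<^sub>E i\<in>{..<n}. u i)" by (simp add: points_Q A_def mem_Times_iff)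
        then have "fst q i \<in> u i" by (rule PiE_mem) (simp add: i)
        moreover have "u i \<subseteq> points X" using Union_upper[OF ui[OF i]] \<U>(2) by simp
        ultimately show "fst q i \<in> points (induced_space X (u i))"
          unfolding points_induced_space by (meson IntI subsetD)
      next
        fix s assume "s \<in> S i"
        then have "(\<lambda>q. s (fst q i)) \<in> C" unfolding C_def by (intro UnI1 UN_I[of i] imageI) (simp_all add: i)
        then show "regular Q (points Q) (\<lambda>q. s (fst q i))" by (intro reg subsetD[OF R(3)])
      qed
      from morphism_comp[OF this morphism_induced_space_inclusion]
      show "morphism Q X (\<lambda>q. fst q i)" .
    qed (simp add: points_Q A_def mem_Times_iff PiE_iff)
    have "morphism Q (induced_space Y W) snd"
    proof (rule S'(2)[rule_format, OF Q])
      fix q assume "q \<in> points Q"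
      then show "snd q \<in> points (induced_space Y W)"
        using Union_upper[OF W] \<W>(2)
        by (simp add: points_induced_space points_Q A_def mem_Times_iff subset_iff)
    next
      fix s assume "s \<in> S'"
      then have "(\<lambda>q. s (snd q)) \<in> C" unfolding C_def by (intro UnI2 imageI)
      then show "regular Q (points Q) (\<lambda>q. s (snd q))" by (intro reg subsetD[OF R(3)])
    qed
    from morphism_comp[OF this morphism_induced_space_inclusion] have snd: "morphism Q Y snd" .
    \<comment> \<open>Both projections are morphisms because the coordinate functions in
      \<open>C\<close> are regular on \<open>Q\<close>; their pairing is the identity.\<close>
    from morphism_Pair[OF Q sXn sY fst snd]
    have id: "morphism Q (prod_space (power_space n X) Y) (\<lambda>q. q)" by simp
    have "openin (zariski Q) (points Q \<inter> D)" if "openin ?T D" for D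
      using morphism_openin_vimage[OF id that] by (simp add: Int_def)
    moreover have "noetherian_topology (zariski Q)"
      unfolding Q_def by (rule noetherian_fraction_space[OF R(1,2)])
    ultimately show ?thesis using points_Q unfolding A_def by (intro exI[of _ "zariski Q"]) simp
  qed
  then obtain t where t: "\<And>u W. u \<in> {..<n} \<rightarrow>\<^sub>E \<U> \<Longrightarrow> W \<in> \<W> \<Longrightarrow>
      topspace (t u W) = (\<Pi>\<^sub>E i\<in>{..<n}. u i) \<times> W \<and> noetherian_topology (t u W) \<and>
      (\<forall>D. openin ?T D \<longrightarrow> openin (t u W) (topspace (t u W) \<inter> D))" by metis
  let ?\<T> = "(\<lambda>(u, W). t u W) ` (({..<n} \<rightarrow>\<^sub>E \<U>) \<times> \<W>)"
  show ?thesis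
  proof (rule noetherian_topology_cover[where \<T> = ?\<T>])
    show "finite ?\<T>" using \<U>(1) \<W>(1) by (simp add: finite_PiE)
    show "topspace ?T \<subseteq> (\<Union>S\<in>?\<T>. topspace S)"
    proof
      fix z assume "z \<in> topspace ?T"
      then have "z \<in> (\<Pi>\<^sub>E i\<in>{..<n}. \<Union>\<U>) \<times> \<Union>\<W>"
        by (simp only: points_prod_space[OF sXn sY] points_power_space[OF sX] \<U>(2) \<W>(2))
      then have z: "fst z \<in> (\<Pi>\<^sub>E i\<in>{..<n}. \<Union>\<U>)" "snd z \<in> \<Union>\<W>"
        by (simp_all only: mem_Times_iff)
      then obtain W where W: "W \<in> \<W>" "snd z \<in> W" by blast
      have "\<forall>i\<in>{..<n}. \<exists>U. U \<in> \<U> \<and> fst z i \<in> U"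
        using PiE_mem[OF z(1)] by (simp only: Union_iff) blast
      then obtain u where u: "\<forall>i\<in>{..<n}. u i \<in> \<U> \<and> fst z i \<in> u i" by metis
      let ?u = "restrict u {..<n}"
      have "?u \<in> {..<n} \<rightarrow>\<^sub>E \<U>" using u by auto
      moreover have "z \<in> (\<Pi>\<^sub>E i\<in>{..<n}. ?u i) \<times> W"
        using u W PiE_arb[OF z(1)] by (auto simp: mem_Times_iff PiE_iff extensional_def)
      ultimately show "z \<in> (\<Union>S\<in>?\<T>. topspace S)" using t[of ?u W] W(1)
        by (intro UN_I[of "t ?u W"] image_eqI[of _ _ "(?u, W)"]) simp_all
    qed
  qed (use t in auto)
qed

lemma noetherian_open_finite_union:
  assumes F: "fraction_family F" and noeth: "noetherian_topology (zariski (fraction_space F))"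
    and U: "openin (zariski (fraction_space F)) U"
  shows "\<exists>F'\<subseteq>F. finite F' \<and> U = (\<Union>(D, f)\<in>F'. {x \<in> D. f x \<noteq> 0})"
proof -
  let ?b = "\<lambda>(D, f). {x \<in> D. f x \<noteq> 0}"
  let ?F = "{p \<in> F. ?b p \<subseteq> U}"
  have "\<forall>D\<in>?b ` ?F. openin (zariski (fraction_space F)) D"
    using openin_fraction_space_basic by (auto simp: case_prod_beta)
  from noeth[unfolded noetherian_topology_def, THEN spec, THEN mp, OF this]
  obtain \<E> where \<E>: "\<E> \<subseteq> ?b ` ?F" "finite \<E>" "\<Union>\<E> = \<Union>(?b ` ?F)" by (elim exE conjE)
  from finite_subset_image[OF \<E>(2,1)] obtain F' where
    F': "F' \<subseteq> ?F" "finite F'" "\<E> = ?b ` F'" by (elim exE conjE)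
  have "U \<subseteq> \<Union>(?b ` ?F)"
  proof
    fix x assume "x \<in> U"
    from fraction_space_base[OF F U this] obtain D f where
      "(D, f) \<in> F" "x \<in> D" "f x \<noteq> 0" "{y \<in> D. f y \<noteq> 0} \<subseteq> U" by blast
    then show "x \<in> \<Union>(?b ` ?F)" by (intro UN_I[of "(D, f)"]) auto
  qed
  then have "U = \<Union>(?b ` F')" using \<E>(3) F'(3) by auto
  then show ?thesis using F'(1,2) by (intro exI[of _ F']) auto
qed

section \<open>Uniform families of unions of cosets\<close>

text \<open>In \<open>uniform_cosets\<close>, both \<open>\<S>\<close> and \<open>N\<close> are
  common to all members of the family; together they bound the length of the sequence of algebraic
  subgroups at the end.\<close>

definition union_of_cosets ::
  "('c, 'm) monoid_scheme \<Rightarrow> 'c set \<Rightarrow> 'c set set \<Rightarrow> nat \<Rightarrow> 'c set \<Rightarrow> bool" where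
  "union_of_cosets M \<Delta> \<S> N A \<longleftrightarrow> (\<exists>\<C>. finite \<C> \<and> card \<C> \<le> N \<and> A = \<Union>\<C> \<and>
    (\<forall>C\<in>\<C>. \<exists>\<gamma>\<in>\<Delta>. \<exists>S\<in>\<S>. C = \<gamma> <#\<^bsub>M\<^esub> S))"

definition uniform_cosets :: "('c, 'm) monoid_scheme \<Rightarrow> 'c set \<Rightarrow> 'c set set \<Rightarrow> bool" where
  "uniform_cosets M \<Delta> \<A> \<longleftrightarrow> (\<exists>\<S> N. finite \<S> \<and> (\<forall>S\<in>\<S>. subgroup S M \<and> S \<subseteq> \<Delta>) \<and>
    (\<forall>A\<in>\<A>. union_of_cosets M \<Delta> \<S> N A))"

lemma union_of_cosets_mono:
  assumes "union_of_cosets M \<Delta> \<S> N A" "\<S> \<subseteq> \<S>'" "N \<le> N'"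
  shows "union_of_cosets M \<Delta> \<S>' N' A"
proof -
  from assms(1) obtain \<C> where "finite \<C>" "card \<C> \<le> N" "A = \<Union>\<C>"
    "\<forall>C\<in>\<C>. \<exists>\<gamma>\<in>\<Delta>. \<exists>S\<in>\<S>. C = \<gamma> <#\<^bsub>M\<^esub> S" unfolding union_of_cosets_def by (elim exE conjE)
  then show ?thesis
    unfolding union_of_cosets_def using assms(2,3) by (intro exI[of _ \<C>]) (meson le_trans subsetD)
qed

lemma uniform_cosetsE:
  assumes "uniform_cosets M \<Delta> \<A>"
  obtains \<S> N where "finite \<S>" "\<And>S. S \<in> \<S> \<Longrightarrow> subgroup S M" "\<And>S. S \<in> \<S> \<Longrightarrow> S \<subseteq> \<Delta>"
    "\<And>A. A \<in> \<A> \<Longrightarrow> union_of_cosets M \<Delta> \<S> N A"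
  using assms that unfolding uniform_cosets_def by metis

lemma uniform_cosetsI:
  assumes "finite \<S>" "\<And>S. S \<in> \<S> \<Longrightarrow> subgroup S M" "\<And>S. S \<in> \<S> \<Longrightarrow> S \<subseteq> \<Delta>"
    "\<And>A. A \<in> \<A> \<Longrightarrow> union_of_cosets M \<Delta> \<S> N A"
  shows "uniform_cosets M \<Delta> \<A>"
  unfolding uniform_cosets_def
  by (rule exI[of _ \<S>], rule exI[of _ N]) (use assms in simp)

lemma uniform_cosets_subset: "uniform_cosets M \<Delta> \<B> \<Longrightarrow> \<A> \<subseteq> \<B> \<Longrightarrow> uniform_cosets M \<Delta> \<A>"
  unfolding uniform_cosets_def by (meson subsetD)

lemma uniform_cosets_empty: "uniform_cosets M \<Delta> {}"
  by (rule uniform_cosetsI[of "{}"]) auto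

lemma uniform_cosets_Un:
  assumes "uniform_cosets M \<Delta> \<A>" "uniform_cosets M \<Delta> \<B>"
  shows "uniform_cosets M \<Delta> (\<A> \<union> \<B>)"
proof -
  from assms(1) obtain \<S> N where *: "finite \<S>" "\<And>S. S \<in> \<S> \<Longrightarrow> subgroup S M"
    "\<And>S. S \<in> \<S> \<Longrightarrow> S \<subseteq> \<Delta>" "\<And>A. A \<in> \<A> \<Longrightarrow> union_of_cosets M \<Delta> \<S> N A"
    by (elim uniform_cosetsE) (rule that)
  from assms(2) obtain \<S>' N' where **: "finite \<S>'" "\<And>S. S \<in> \<S>' \<Longrightarrow> subgroup S M"
    "\<And>S. S \<in> \<S>' \<Longrightarrow> S \<subseteq> \<Delta>" "\<And>A. A \<in> \<B> \<Longrightarrow> union_of_cosets M \<Delta> \<S>' N' A"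
    by (elim uniform_cosetsE) (rule that)
  show ?thesis
  proof (rule uniform_cosetsI[of "\<S> \<union> \<S>'"])
    fix A assume "A \<in> \<A> \<union> \<B>"
    then show "union_of_cosets M \<Delta> (\<S> \<union> \<S>') (max N N') A"
    proof
      assume "A \<in> \<A>"
      from *(4)[OF this] show ?thesis by (rule union_of_cosets_mono) simp_all
    next
      assume "A \<in> \<B>"
      from **(4)[OF this] show ?thesis by (rule union_of_cosets_mono) simp_all
    qed
  next
    fix S assume "S \<in> \<S> \<union> \<S>'"
    then show "subgroup S M" "S \<subseteq> \<Delta>" using *(2,3) **(2,3) by (metis UnE)+
  qed (use *(1) **(1) in simp)
qed

lemma uniform_cosets_UN:
  assumes "finite J" "\<And>j. j \<in> J \<Longrightarrow> uniform_cosets M \<Delta> (\<A> j)"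
  shows "uniform_cosets M \<Delta> (\<Union>j\<in>J. \<A> j)"
  using assms by induction (auto simp: uniform_cosets_empty intro: uniform_cosets_Un)

section \<open>Intersections of cosets, closures of cosets and of subgroups\<close>

context group
begin

lemma uniform_cosets_whole:
  assumes "subgroup \<Delta> G"
  shows "uniform_cosets G \<Delta> {\<Delta>}"
proof (rule uniform_cosetsI[of "{\<Delta>}"])
  have "\<Delta> = \<one> <# \<Delta>" using lcos_mult_one[OF subgroup.subset[OF assms]] by simp
  then have "\<exists>\<gamma>\<in>\<Delta>. \<Delta> = \<gamma> <# \<Delta>" using subgroup.one_closed[OF assms] by blast
  then show "union_of_cosets G \<Delta> {\<Delta>} 1 A" if "A \<in> {\<Delta>}" for A
    unfolding union_of_cosets_def using that by (intro exI[of _ "{\<Delta>}"]) simp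
qed (use assms in auto)

lemma l_coset_Int:
  assumes "x \<in> carrier G" "S \<subseteq> carrier G" "T \<subseteq> carrier G"
  shows "(x <# S) \<inter> (x <# T) = x <# (S \<inter> T)"
  using assms by (auto simp: l_coset_def subset_iff)

text \<open>If a coset of \<open>S\<close> meets a coset of \<open>T\<close> in \<open>x\<close>,
  both can be rewritten with representative \<open>x\<close>, and they meet in the coset of
  \<open>S \<inter> T\<close> through \<open>x\<close>. Hence the pairwise intersections of
  subgroups suffice, with the bound \<open>N * N'\<close>.\<close>

lemma uniform_cosets_Int:
  assumes \<Delta>: "subgroup \<Delta> G" and "uniform_cosets G \<Delta> \<A>" "uniform_cosets G \<Delta> \<B>"
  shows "uniform_cosets G \<Delta> {A \<inter> B |A B. A \<in> \<A> \<and> B \<in> \<B>}"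
proof -
  from assms(2) obtain \<S> N where *: "finite \<S>" "\<And>S. S \<in> \<S> \<Longrightarrow> subgroup S G"
    "\<And>S. S \<in> \<S> \<Longrightarrow> S \<subseteq> \<Delta>" "\<And>A. A \<in> \<A> \<Longrightarrow> union_of_cosets G \<Delta> \<S> N A"
    by (elim uniform_cosetsE) (rule that)
  from assms(3) obtain \<S>' N' where **: "finite \<S>'" "\<And>S. S \<in> \<S>' \<Longrightarrow> subgroup S G"
    "\<And>S. S \<in> \<S>' \<Longrightarrow> S \<subseteq> \<Delta>" "\<And>A. A \<in> \<B> \<Longrightarrow> union_of_cosets G \<Delta> \<S>' N' A"
    by (elim uniform_cosetsE) (rule that)
  let ?\<S> = "(\<lambda>(S, T). S \<inter> T) ` (\<S> \<times> \<S>')"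
  show ?thesis
  proof (rule uniform_cosetsI[of ?\<S>])
    show "finite ?\<S>" using *(1) **(1) by simp
    fix S assume "S \<in> ?\<S>"
    then obtain S1 S2 where S: "S1 \<in> \<S>" "S2 \<in> \<S>'" "S = S1 \<inter> S2" by auto
    show "subgroup S G" unfolding S(3) using *(2)[OF S(1)] **(2)[OF S(2)] by (rule subgroups_Inter_pair)
    show "S \<subseteq> \<Delta>" using *(3)[OF S(1)] S(3) by blast
  next
    fix E assume "E \<in> {A \<inter> B |A B. A \<in> \<A> \<and> B \<in> \<B>}"
    then obtain A B where E: "A \<in> \<A>" "B \<in> \<B>" "E = A \<inter> B" by blast
    from *(4)[OF E(1)] obtain \<C> where \<C>: "finite \<C>" "card \<C> \<le> N" "A = \<Union>\<C>"
      "\<forall>C\<in>\<C>. \<exists>\<gamma>\<in>\<Delta>. \<exists>S\<in>\<S>. C = \<gamma> <# S" unfolding union_of_cosets_def by (elim exE conjE)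
    from **(4)[OF E(2)] obtain \<D> where \<D>: "finite \<D>" "card \<D> \<le> N'" "B = \<Union>\<D>"
      "\<forall>C\<in>\<D>. \<exists>\<gamma>\<in>\<Delta>. \<exists>S\<in>\<S>'. C = \<gamma> <# S" unfolding union_of_cosets_def by (elim exE conjE)
    \<comment> \<open>The empty set is removed because it is not a coset.\<close>
    let ?\<E> = "(\<lambda>(C, D). C \<inter> D) ` (\<C> \<times> \<D>) - {{}}"
    have fin: "finite ((\<lambda>(C, D). C \<inter> D) ` (\<C> \<times> \<D>))" using \<C>(1) \<D>(1) by simp
    have "card ?\<E> \<le> card ((\<lambda>(C, D). C \<inter> D) ` (\<C> \<times> \<D>))" by (rule card_mono[OF fin]) blast
    also have "\<dots> \<le> card (\<C> \<times> \<D>)" by (rule card_image_le) (use \<C>(1) \<D>(1) in simp)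
    also have "\<dots> \<le> N * N'" using \<C>(2) \<D>(2) by (simp add: card_cartesian_product mult_le_mono)
    finally have card: "card ?\<E> \<le> N * N'" .
    have union: "E = \<Union>?\<E>" unfolding E(3) \<C>(3) \<D>(3) by auto
    have "\<exists>\<gamma>\<in>\<Delta>. \<exists>S\<in>?\<S>. F = \<gamma> <# S" if F: "F \<in> ?\<E>" for F
    proof -
      from F obtain C D x where CD: "C \<in> \<C>" "D \<in> \<D>" "F = C \<inter> D" "x \<in> F" by auto
      from \<C>(4) CD(1) obtain \<gamma> S where S: "\<gamma> \<in> \<Delta>" "S \<in> \<S>" "C = \<gamma> <# S" by blast
      from \<D>(4) CD(2) obtain \<delta> T where T: "\<delta> \<in> \<Delta>" "T \<in> \<S>'" "D = \<delta> <# T" by blast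
      have carr: "\<gamma> \<in> carrier G" "\<delta> \<in> carrier G" using S(1) T(1) subgroup.subset[OF \<Delta>] by auto
      have C: "C = x <# S" unfolding S(3)
        by (rule l_repr_independence[OF _ carr(1) *(2)[OF S(2)]]) (use CD S in auto)
      have D: "D = x <# T" unfolding T(3)
        by (rule l_repr_independence[OF _ carr(2) **(2)[OF T(2)]]) (use CD T in auto)
      obtain s where "s \<in> S" "x = \<gamma> \<otimes> s" using CD S(3) by (auto simp: l_coset_def)
      then have x: "x \<in> \<Delta>" using S(1) *(3)[OF S(2)] subgroup.m_closed[OF \<Delta>] by blast
      then have "x \<in> carrier G" using subgroup.subset[OF \<Delta>] by blast
      from l_coset_Int[OF this subgroup.subset[OF *(2)[OF S(2)]] subgroup.subset[OF **(2)[OF T(2)]]]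
      have "F = x <# (S \<inter> T)" unfolding CD(3) C D .
      moreover have "S \<inter> T \<in> ?\<S>" using S(2) T(2) by (intro image_eqI[of _ _ "(S, T)"]) simp_all
      ultimately show ?thesis using x by (intro bexI[of _ x] bexI[of _ "S \<inter> T"])
    qed
    moreover have "finite ?\<E>" using fin by simp
    ultimately show "union_of_cosets G \<Delta> ?\<S> (N * N') E"
      unfolding union_of_cosets_def using card union by (intro exI[of _ ?\<E>] conjI ballI)
  qed
qed

lemma l_coset_image: "x <# S = (\<lambda>y. x \<otimes> y) ` S"
  by (auto simp: l_coset_def)

text \<open>Left translation by \<open>a\<close> is a homeomorphism, with translation by
  \<open>inv a\<close> as its inverse; continuity of each of the two gives one inclusion.\<close>

lemma closure_of_l_coset:
  assumes T: "topspace T = carrier G" and left: "\<And>a. a \<in> carrier G \<Longrightarrow> continuous_map T T (\<lambda>x. a \<otimes> x)"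
    and a: "a \<in> carrier G" and S: "S \<subseteq> carrier G"
  shows "T closure_of (a <# S) = a <# (T closure_of S)"
proof
  show "a <# (T closure_of S) \<subseteq> T closure_of (a <# S)"
    unfolding l_coset_image by (rule continuous_map_image_closure_subset[OF left[OF a]])
  have "(\<lambda>x. inv a \<otimes> x) ` (T closure_of (a <# S)) \<subseteq> T closure_of ((\<lambda>x. inv a \<otimes> x) ` (a <# S))"
    by (rule continuous_map_image_closure_subset[OF left]) (use a in simp)
  moreover have "inv a \<otimes> (a \<otimes> s) = s" if "s \<in> S" for s
  proof -
    have "s \<in> carrier G" using that S by blast
    then show ?thesis using a by (simp flip: m_assoc)
  qed
  then have "(\<lambda>x. inv a \<otimes> x) ` (a <# S) = S"
    by (force simp: l_coset_image image_image)
  ultimately have sub: "(\<lambda>x. inv a \<otimes> x) ` (T closure_of (a <# S)) \<subseteq> T closure_of S" by simp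
  show "T closure_of (a <# S) \<subseteq> a <# (T closure_of S)"
  proof
    fix x assume x: "x \<in> T closure_of (a <# S)"
    then have "x \<in> carrier G" using closure_of_subset_topspace[of T] T by blast
    then have "x = a \<otimes> (inv a \<otimes> x)" using a by (simp flip: m_assoc)
    then show "x \<in> a <# (T closure_of S)" using sub x unfolding l_coset_image by blast
  qed
qed

text \<open>The Zariski topology of a product is not the product topology, so multiplication is only
  assumed continuous in each variable. Closure under products therefore takes two passes: left
  translations by elements of \<open>S\<close> preserve the closure, and then right translations by
  elements of the closure do.\<close>

lemma subgroup_closure_of:
  assumes T: "topspace T = carrier G" and left: "\<And>a. a \<in> carrier G \<Longrightarrow> continuous_map T T (\<lambda>x. a \<otimes> x)"
    and right: "\<And>a. a \<in> carrier G \<Longrightarrow> continuous_map T T (\<lambda>x. x \<otimes> a)"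
    and inv: "continuous_map T T (\<lambda>x. inv x)" and S: "subgroup S G"
  shows "subgroup (T closure_of S) G"
proof (rule subgroupI)
  let ?C = "T closure_of S"
  show C: "?C \<subseteq> carrier G" using closure_of_subset_topspace[of T S] T by simp
  have SC: "S \<subseteq> ?C" using closure_of_subset[of S T] subgroup.subset[OF S] T by simp
  show "?C \<noteq> {}" using SC subgroup.one_closed[OF S] by blast
  show "inv a \<in> ?C" if "a \<in> ?C" for a
  proof -
    have "(\<lambda>x. inv x) ` S \<subseteq> S" using subgroup.m_inv_closed[OF S] by blast
    from closure_of_mono[OF this, of T] show ?thesis
      using continuous_map_image_closure_subset[OF inv, of S] that by blast
  qed
  have SCC: "s \<otimes> c \<in> ?C" if "s \<in> S" "c \<in> ?C" for s c
  proof -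
    have s: "s \<in> carrier G" using that subgroup.subset[OF S] by blast
    have "(\<lambda>x. s \<otimes> x) ` S \<subseteq> S" using subgroup.m_closed[OF S] that by blast
    from closure_of_mono[OF this, of T] show ?thesis
      using continuous_map_image_closure_subset[OF left[OF s], of S] that by blast
  qed
  show "a \<otimes> b \<in> ?C" if "a \<in> ?C" "b \<in> ?C" for a b
  proof -
    have b: "b \<in> carrier G" using that C by blast
    have "(\<lambda>x. x \<otimes> b) ` S \<subseteq> ?C" using SCC that by blast
    then have "T closure_of ((\<lambda>x. x \<otimes> b) ` S) \<subseteq> ?C" by (rule closure_of_minimal) simp
    then show ?thesis
      using continuous_map_image_closure_subset[OF right[OF b], of S] that by blast
  qed
qed

end

section \<open>Lang type subgroups\<close>

text \<open>The point \<open>x\<close> on the first \<open>n\<close> coordinates, followed by the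
  parameter. The first \<open>n\<close> entries of \<open>y\<close> are ignored, so the parameter
  can be a full point of the \<open>N\<close>-th power without any shift of indices; for
  \<open>N = n\<close> no parameter remains.\<close>

definition glue :: "nat \<Rightarrow> nat \<Rightarrow> (nat \<Rightarrow> 'a) \<Rightarrow> (nat \<Rightarrow> 'a) \<Rightarrow> nat \<Rightarrow> 'a" where
  "glue n N x y = (\<lambda>i\<in>{..<N}. if i < n then x i else y i)"

lemma glue_in_PiE: "x \<in> {..<n} \<rightarrow>\<^sub>E A \<Longrightarrow> y \<in> {..<N} \<rightarrow>\<^sub>E A \<Longrightarrow> glue n N x y \<in> {..<N} \<rightarrow>\<^sub>E A"
  unfolding glue_def restrict_PiE_iff by (simp add: PiE_iff)

lemma glue_same: "x \<in> {..<n} \<rightarrow>\<^sub>E A \<Longrightarrow> glue n n x y = x"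
  unfolding glue_def by (intro ext) (simp add: PiE_iff extensional_def)

section \<open>Translations, closures and gluing in powers of the group\<close>

context algebraic_group
begin

lemma space_with_functions_V: "space_with_functions V"
  by (rule variety_space_with_functions[OF variety])

lemma group_group_power: "group (group_power n G)"
  by (simp add: group_axioms)

lemma points_power: "points (power_space n V) = {..<n} \<rightarrow>\<^sub>E carrier G"
  by (simp add: points_power_space[OF space_with_functions_V] carrier_eq_points)

lemma morphism_left_translation: "a \<in> carrier G \<Longrightarrow> morphism V V (\<lambda>x. a \<otimes> x)"
  using morphism_comp[OF morphism_Pair[OF space_with_functions_V space_with_functions_V
        space_with_functions_V morphism_const[OF space_with_functions_V, of a V] morphism_id] mult_morphism]
  by (simp add: carrier_eq_points)

lemma morphism_right_translation: "a \<in> carrier G \<Longrightarrow> morphism V V (\<lambda>x. x \<otimes> a)"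
  using morphism_comp[OF morphism_Pair[OF space_with_functions_V space_with_functions_V
        space_with_functions_V morphism_id morphism_const[OF space_with_functions_V, of a V]] mult_morphism]
  by (simp add: carrier_eq_points)

lemma continuous_map_coordinatewise:
  assumes "n > 0" "\<And>i. i < n \<Longrightarrow> morphism V V (f i)"
  shows "continuous_map (zariski (power_space n V)) (zariski (power_space n V)) (\<lambda>x. \<lambda>i\<in>{..<n}. f i (x i))"
proof (rule morphism_continuous, rule morphism_to_power_space)
  show "morphism (power_space n V) V (\<lambda>x. (\<lambda>i\<in>{..<n}. f i (x i)) i)" if "i < n" for i
    using morphism_comp[OF morphism_coordinate[OF space_with_functions_V that] assms(2)[OF that]] that
    by simp
qed (use assms space_with_functions_V space_with_functions_power_space in auto)

lemma
  assumes n: "n > 0"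
  shows continuous_map_power_left: "a \<in> carrier (group_power n G) \<Longrightarrow>
      continuous_map (zariski (power_space n V)) (zariski (power_space n V)) (\<lambda>x. a \<otimes>\<^bsub>group_power n G\<^esub> x)"
    and continuous_map_power_right: "a \<in> carrier (group_power n G) \<Longrightarrow>
      continuous_map (zariski (power_space n V)) (zariski (power_space n V)) (\<lambda>x. x \<otimes>\<^bsub>group_power n G\<^esub> a)"
    and continuous_map_power_inv:
      "continuous_map (zariski (power_space n V)) (zariski (power_space n V)) (\<lambda>x. inv\<^bsub>group_power n G\<^esub> x)"
proof -
  let ?T = "zariski (power_space n V)"
  show "continuous_map ?T ?T (\<lambda>x. a \<otimes>\<^bsub>group_power n G\<^esub> x)" if "a \<in> carrier (group_power n G)"
    using continuous_map_coordinatewise[OF n, of "\<lambda>i x. a i \<otimes> x"] morphism_left_translation that by auto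
  show "continuous_map ?T ?T (\<lambda>x. x \<otimes>\<^bsub>group_power n G\<^esub> a)" if "a \<in> carrier (group_power n G)"
    using continuous_map_coordinatewise[OF n, of "\<lambda>i x. x \<otimes> a i"] morphism_right_translation that by auto
  show "continuous_map ?T ?T (\<lambda>x. inv\<^bsub>group_power n G\<^esub> x)"
    by (rule continuous_map_eq[OF continuous_map_coordinatewise[OF n, of "\<lambda>i x. inv x"]])
      (use inv_morphism group_axioms in \<open>auto simp: points_power\<close>)
qed

lemma algebraic_subgroup_closure_of:
  assumes "n > 0" "subgroup S (group_power n G)"
  shows "algebraic_subgroup n G V (zariski (power_space n V) closure_of S)"
  unfolding algebraic_subgroup_def
  using group.subgroup_closure_of[OF group_group_power _ continuous_map_power_left
      continuous_map_power_right continuous_map_power_inv assms(2)] assms(1)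
  by (simp add: points_power)

lemma closure_of_power_coset:
  assumes "n > 0" "S \<subseteq> carrier (group_power n G)" "a \<in> carrier (group_power n G)"
  shows "zariski (power_space n V) closure_of (a <#\<^bsub>group_power n G\<^esub> S) =
    a <#\<^bsub>group_power n G\<^esub> (zariski (power_space n V) closure_of S)"
  by (rule group.closure_of_l_coset[OF group_group_power _ continuous_map_power_left])
    (use assms in \<open>auto simp: points_power\<close>)

text \<open>Right multiplication of \<open>x\<close> by \<open>t\<close> with \<open>y\<close> fixed
  is right multiplication of the glued point by \<open>t\<close> glued with the identity. The right
  side is the one that fits left cosets.\<close>

lemma glue_mult:
  assumes "x \<in> carrier (group_power n G)" "t \<in> carrier (group_power n G)"
    "y \<in> carrier (group_power N G)"
  shows "glue n N (x \<otimes>\<^bsub>group_power n G\<^esub> t) y =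
    glue n N x y \<otimes>\<^bsub>group_power N G\<^esub> glue n N t \<one>\<^bsub>group_power N G\<^esub>"
  using assms by (intro ext) (simp add: glue_def PiE_iff)

lemma glue_one_mult:
  assumes "x \<in> carrier (group_power n G)" "t \<in> carrier (group_power n G)"
  shows "glue n N (x \<otimes>\<^bsub>group_power n G\<^esub> t) \<one>\<^bsub>group_power N G\<^esub> =
    glue n N x \<one>\<^bsub>group_power N G\<^esub> \<otimes>\<^bsub>group_power N G\<^esub> glue n N t \<one>\<^bsub>group_power N G\<^esub>"
  by (rule glue_mult[OF assms]) simp

end

section \<open>Fibres over parameters in powers of \<Gamma>\<close>

locale Lang_type_subgroup = algebraic_group G V for G :: "'a monoid" (structure) and V :: "('a, 'k::alg_closed_field) fun_space" +
  fixes \<Gamma> :: "'a set"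
  assumes \<Gamma>: "subgroup \<Gamma> G" and Lang: "Lang_type G V \<Gamma>"
begin

lemma set_power_subgroup: "subgroup (set_power n \<Gamma>) (group_power n G)"
  using \<Gamma> by (simp add: PiE_subgroup_product_group group_axioms)

lemma set_power_subset: "set_power n \<Gamma> \<subseteq> carrier (group_power n G)"
  by (rule subgroup.subset[OF set_power_subgroup])

lemma one_in_set_power: "\<one>\<^bsub>group_power n G\<^esub> \<in> set_power n \<Gamma>"
  by (rule subgroup.one_closed[OF set_power_subgroup])

text \<open>The fibre of \<open>S\<close> over the identity: the preimage of \<open>S\<close> under
  the homomorphism that fills the remaining coordinates with the identity.\<close>

lemma subgroup_glue_vimage:
  assumes S: "subgroup S (group_power N G)"
  shows "subgroup {s \<in> set_power n \<Gamma>. glue n N s \<one>\<^bsub>group_power N G\<^esub> \<in> S} (group_power n G)"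
    (is "subgroup ?S ?M")
proof -
  interpret M: group ?M by (rule group_group_power)
  interpret MN: group "group_power N G" by (rule group_group_power)
  let ?\<iota> = "\<lambda>s. glue n N s \<one>\<^bsub>group_power N G\<^esub>"
  have carr: "?\<iota> s \<in> carrier (group_power N G)" if "s \<in> carrier ?M" for s
    using that glue_in_PiE[of s n "carrier G" "\<one>\<^bsub>group_power N G\<^esub>" N] MN.one_closed by simp
  \<comment> \<open>The image of the identity is idempotent, hence the identity.\<close>
  have one: "?\<iota> \<one>\<^bsub>?M\<^esub> = \<one>\<^bsub>group_power N G\<^esub>"
    using glue_one_mult[OF M.one_closed M.one_closed, of N] carr[OF M.one_closed]
    by (metis M.l_one M.one_closed MN.l_cancel_one)
  show ?thesis
  proof (rule M.subgroupI)
    show "?S \<subseteq> carrier ?M" using set_power_subset by blast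
    have "\<one>\<^bsub>?M\<^esub> \<in> ?S"
      by (intro CollectI conjI one_in_set_power) (simp only: one subgroup.one_closed[OF S])
    then show "?S \<noteq> {}" by blast
    show "inv\<^bsub>?M\<^esub> a \<in> ?S" if a: "a \<in> ?S" for a
    proof -
      have a': "a \<in> carrier ?M" using a set_power_subset by blast
      have "?\<iota> (inv\<^bsub>?M\<^esub> a) \<otimes>\<^bsub>group_power N G\<^esub> ?\<iota> a = \<one>\<^bsub>group_power N G\<^esub>"
        using glue_one_mult[OF M.inv_closed[OF a'] a', of N] by (simp only: M.l_inv[OF a'] one)
      then have "?\<iota> (inv\<^bsub>?M\<^esub> a) = inv\<^bsub>group_power N G\<^esub> (?\<iota> a)"
        using carr[OF a'] carr[OF M.inv_closed[OF a']] by (metis MN.inv_equality)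
      then show ?thesis
        using a subgroup.m_inv_closed[OF S] subgroup.m_inv_closed[OF set_power_subgroup]
        by (intro CollectI conjI) (simp_all only: mem_Collect_eq)
    qed
    show "a \<otimes>\<^bsub>?M\<^esub> b \<in> ?S" if "a \<in> ?S" "b \<in> ?S" for a b
    proof -
      have "a \<in> carrier ?M" "b \<in> carrier ?M" using that set_power_subset by blast+
      from glue_one_mult[OF this, of N] show ?thesis
        using that subgroup.m_closed[OF S] subgroup.m_closed[OF set_power_subgroup]
        by (intro CollectI conjI) (simp_all only: mem_Collect_eq)
    qed
  qed
qed

text \<open>The coset can be represented by \<open>x0\<close> glued with \<open>y\<close>. By
  \<open>glue_mult\<close>, moving from \<open>x0\<close> to \<open>x0\<close> times
  \<open>t\<close> stays in it exactly if \<open>t\<close> glued with the identity lies in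
  \<open>S\<close>. Only the representative \<open>x0\<close> depends on the parameter; the subgroup
  on the right does not.\<close>

lemma glue_fibre_coset:
  assumes \<gamma>: "\<gamma> \<in> carrier (group_power N G)" and S: "subgroup S (group_power N G)"
    and y: "y \<in> set_power N \<Gamma>" and x0: "x0 \<in> set_power n \<Gamma>" "glue n N x0 y \<in> \<gamma> <#\<^bsub>group_power N G\<^esub> S"
  shows "{x \<in> set_power n \<Gamma>. glue n N x y \<in> \<gamma> <#\<^bsub>group_power N G\<^esub> S} =
    x0 <#\<^bsub>group_power n G\<^esub> {s \<in> set_power n \<Gamma>. glue n N s \<one>\<^bsub>group_power N G\<^esub> \<in> S}"
proof -
  let ?M = "group_power n G" and ?N = "group_power N G"
  interpret M: group ?M by (rule group_group_power)
  interpret MN: group ?N by (rule group_group_power)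
  let ?\<iota> = "\<lambda>s. glue n N s \<one>\<^bsub>?N\<^esub>"
  have y': "y \<in> carrier ?N" and x0': "x0 \<in> carrier ?M" using y x0 set_power_subset by blast+
  have carr: "glue n N s z \<in> carrier ?N" if "s \<in> carrier ?M" "z \<in> carrier ?N" for s z
    using that glue_in_PiE[of s n "carrier G" z N] by simp
  have coset: "\<gamma> <#\<^bsub>?N\<^esub> S = glue n N x0 y <#\<^bsub>?N\<^esub> S"
    by (rule MN.l_repr_independence[OF x0(2) \<gamma> S])
  have iff: "glue n N (x0 \<otimes>\<^bsub>?M\<^esub> t) y \<in> \<gamma> <#\<^bsub>?N\<^esub> S \<longleftrightarrow> ?\<iota> t \<in> S" if t: "t \<in> carrier ?M" for t
  proof -
    have cancel: "glue n N x0 y \<otimes>\<^bsub>?N\<^esub> ?\<iota> t = glue n N x0 y \<otimes>\<^bsub>?N\<^esub> s \<longleftrightarrow> ?\<iota> t = s" if "s \<in> S" for s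
      using MN.Units_l_cancel carr[OF x0' y'] carr[OF t MN.one_closed]
        subsetD[OF subgroup.subset[OF S] that] unfolding MN.Units_eq by blast
    have "glue n N (x0 \<otimes>\<^bsub>?M\<^esub> t) y \<in> \<gamma> <#\<^bsub>?N\<^esub> S \<longleftrightarrow>
        (\<exists>s\<in>S. glue n N x0 y \<otimes>\<^bsub>?N\<^esub> ?\<iota> t = glue n N x0 y \<otimes>\<^bsub>?N\<^esub> s)"
      unfolding coset unfolding glue_mult[OF x0' t y'] MN.l_coset_image image_iff by (rule refl)
    also have "\<dots> \<longleftrightarrow> (\<exists>s\<in>S. ?\<iota> t = s)" by (intro bex_cong refl cancel)
    finally show ?thesis by blast
  qed
  show ?thesis
  proof (intro equalityI subsetI)
    fix x assume "x \<in> {x \<in> set_power n \<Gamma>. glue n N x y \<in> \<gamma> <#\<^bsub>?N\<^esub> S}"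
    then have x: "x \<in> set_power n \<Gamma>" "glue n N x y \<in> \<gamma> <#\<^bsub>?N\<^esub> S" by (simp_all only: mem_Collect_eq)
    define t where "t = inv\<^bsub>?M\<^esub> x0 \<otimes>\<^bsub>?M\<^esub> x"
    have t: "t \<in> set_power n \<Gamma>"
      unfolding t_def by (intro subgroup.m_closed[OF set_power_subgroup]
          subgroup.m_inv_closed[OF set_power_subgroup] x0(1) x(1))
    have x': "x \<in> carrier ?M" by (rule subsetD[OF set_power_subset x(1)])
    have eq: "x = x0 \<otimes>\<^bsub>?M\<^esub> t"
      unfolding t_def using x0' x' by (metis M.inv_solve_left M.inv_closed M.m_closed)
    have "?\<iota> t \<in> S" using iff[OF subsetD[OF set_power_subset t], folded eq] x(2) by (rule iffD1)
    then show "x \<in> x0 <#\<^bsub>?M\<^esub> {s \<in> set_power n \<Gamma>. ?\<iota> s \<in> S}"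
      unfolding M.l_coset_image using t by (intro image_eqI[of _ _ t] eq CollectI conjI)
  next
    fix x assume "x \<in> x0 <#\<^bsub>?M\<^esub> {s \<in> set_power n \<Gamma>. ?\<iota> s \<in> S}"
    then obtain t where t: "t \<in> set_power n \<Gamma>" "?\<iota> t \<in> S" "x = x0 \<otimes>\<^bsub>?M\<^esub> t"
      unfolding M.l_coset_image by blast
    show "x \<in> {x \<in> set_power n \<Gamma>. glue n N x y \<in> \<gamma> <#\<^bsub>?N\<^esub> S}"
      unfolding t(3)
      by (intro CollectI conjI subgroup.m_closed[OF set_power_subgroup x0(1) t(1)]
          iffD2[OF iff[OF subsetD[OF set_power_subset t(1)]] t(2)])
  qed
qed

text \<open>Here the Lang type hypothesis enters the argument. It is applied once, to
  \<open>Y\<close>; each of the finitely many resulting cosets has fibres that are empty or cosets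
  of one fixed subgroup.\<close>

lemma uniform_cosets_fibres:
  assumes N: "N > 0" and Y: "closedin (zariski (power_space N V)) Y"
  shows "uniform_cosets (group_power n G) (set_power n \<Gamma>)
    {{x \<in> set_power n \<Gamma>. glue n N x y \<in> Y} |y. y \<in> set_power N \<Gamma>}"
proof -
  let ?M = "group_power n G" and ?N = "group_power N G"
  have "1 \<le> N" using N by simp
  from Lang[unfolded Lang_type_def, rule_format, OF this Y] obtain \<C> where
    \<C>: "finite \<C>" "Y \<inter> set_power N \<Gamma> = \<Union>\<C>"
      "\<forall>C\<in>\<C>. \<exists>\<gamma> S. \<gamma> \<in> set_power N \<Gamma> \<and> subgroup S ?N \<and> S \<subseteq> set_power N \<Gamma> \<and> C = \<gamma> <#\<^bsub>?N\<^esub> S"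
    by (elim exE conjE)
  obtain \<gamma> S where S: "\<And>C. C \<in> \<C> \<Longrightarrow> \<gamma> C \<in> set_power N \<Gamma>" "\<And>C. C \<in> \<C> \<Longrightarrow> subgroup (S C) ?N"
    "\<And>C. C \<in> \<C> \<Longrightarrow> C = \<gamma> C <#\<^bsub>?N\<^esub> S C" using \<C>(3) by metis
  let ?S = "\<lambda>C. {s \<in> set_power n \<Gamma>. glue n N s \<one>\<^bsub>?N\<^esub> \<in> S C}"
  show ?thesis
  proof (rule uniform_cosetsI[of "?S ` \<C>" _ _ _ "card \<C>"])
    fix A assume "A \<in> {{x \<in> set_power n \<Gamma>. glue n N x y \<in> Y} |y. y \<in> set_power N \<Gamma>}"
    then obtain y where y: "y \<in> set_power N \<Gamma>" and A: "A = {x \<in> set_power n \<Gamma>. glue n N x y \<in> Y}"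
      by blast
    let ?f = "\<lambda>C. {x \<in> set_power n \<Gamma>. glue n N x y \<in> C}"
    have "glue n N x y \<in> Y \<longleftrightarrow> (\<exists>C\<in>\<C>. glue n N x y \<in> C)" if "x \<in> set_power n \<Gamma>" for x
      using \<C>(2) glue_in_PiE[OF that y] by blast
    then have "A = \<Union>(?f ` \<C>)" unfolding A by blast
    \<comment> \<open>Empty fibres are dropped, since only a nonempty one supplies a representative
      \<open>x0\<close>.\<close>
    also have "\<dots> = \<Union>(?f ` \<C> - {{}})" by blast
    finally have union: "A = \<Union>(?f ` \<C> - {{}})" .
    have "card (?f ` \<C> - {{}}) \<le> card \<C>"
      using card_mono[of "?f ` \<C>" "?f ` \<C> - {{}}"] card_image_le[OF \<C>(1), of ?f] \<C>(1) by fastforce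
    moreover have "\<exists>\<gamma>\<in>set_power n \<Gamma>. \<exists>S\<in>?S ` \<C>. E = \<gamma> <#\<^bsub>?M\<^esub> S" if E: "E \<in> ?f ` \<C> - {{}}" for E
    proof -
      from E obtain C x0 where C: "C \<in> \<C>" "E = ?f C" "x0 \<in> E" by blast
      have C': "C = \<gamma> C <#\<^bsub>?N\<^esub> S C" by (rule S(3)[OF C(1)])
      have "E = {x \<in> set_power n \<Gamma>. glue n N x y \<in> \<gamma> C <#\<^bsub>?N\<^esub> S C}" using C(2) C' by simp
      also have "\<dots> = x0 <#\<^bsub>?M\<^esub> ?S C"
        by (rule glue_fibre_coset[OF subsetD[OF set_power_subset S(1)[OF C(1)]] S(2)[OF C(1)] y])
          (use C C' in auto)
      finally show ?thesis using C by (intro bexI[of _ x0] bexI[of _ "?S C"]) auto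
    qed
    ultimately show "union_of_cosets ?M (set_power n \<Gamma>) (?S ` \<C>) (card \<C>) A"
      unfolding union_of_cosets_def using \<C>(1) union by (intro exI[of _ "?f ` \<C> - {{}}"] conjI ballI) simp_all
  next
    show "subgroup T ?M" if "T \<in> ?S ` \<C>" for T using that subgroup_glue_vimage S(2) by blast
  qed (use \<C>(1) in auto)
qed

text \<open>
  Induction on the number of terms, eliminating the coefficient \<open>h k\<close> by means of a solution \<open>x1\<close>,
  which is stored in \<open>n\<close> additional coordinates of the parameter; \<open>\<pi>\<close> and \<open>\<rho>\<close> below recover the
  original point and \<open>x1\<close> glued with the original parameter.
\<close>

lemma uniform_cosets_linear:
  assumes n: "n > 0" and "finite J"
  shows "\<forall>N U g. n \<le> N \<longrightarrow> openin (zariski (power_space N V)) U \<longrightarrow>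
    (\<forall>j\<in>J. regular (power_space N V) U (g j)) \<longrightarrow>
    uniform_cosets (group_power n G) (set_power n \<Gamma>)
      {{x \<in> set_power n \<Gamma>. glue n N x y \<in> U \<longrightarrow> (\<Sum>j\<in>J. g j (glue n N x y) * h j) = 0} |y h.
        y \<in> set_power N \<Gamma>}"
  using assms(2)
\<comment> \<open>\<open>N\<close>, \<open>U\<close> and \<open>g\<close> are quantified in the
  claim because the induction step replaces all three, with \<open>N + n\<close> in place of
  \<open>N\<close>.\<close>
proof (induction J rule: finite_psubset_induct)
  case (psubset J)
  show ?case
  proof (intro allI impI)
    fix N U g
    assume N: "n \<le> N" and U: "openin (zariski (power_space N V)) U"
      and g: "\<forall>j\<in>J. regular (power_space N V) U (g j)"
    let ?P = "power_space N V" and ?N' = "N + n"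
    let ?P' = "power_space ?N' V"
    have N0: "N > 0" and N'0: "?N' > 0" using n N by auto
    note sP = space_with_functions_power_space[OF space_with_functions_V N0]
    note sP' = space_with_functions_power_space[OF space_with_functions_V N'0]
    define \<pi> where "\<pi> = (\<lambda>z::nat \<Rightarrow> 'a. \<lambda>i\<in>{..<N}. z i)"
    define \<rho> where "\<rho> = (\<lambda>z::nat \<Rightarrow> 'a. \<lambda>i\<in>{..<N}. if i < n then z (N + i) else z i)"
    have \<pi>: "morphism ?P' ?P \<pi>"
    proof (rule morphism_to_power_space[OF sP' space_with_functions_V])
      show "morphism ?P' V (\<lambda>z. \<pi> z i)" if "i < N" for i
        using morphism_coordinate[OF space_with_functions_V, of i ?N'] that by (simp add: \<pi>_def)
    qed (simp add: \<pi>_def)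
    have \<rho>: "morphism ?P' ?P \<rho>"
    proof (rule morphism_to_power_space[OF sP' space_with_functions_V])
      show "morphism ?P' V (\<lambda>z. \<rho> z i)" if "i < N" for i
        using morphism_coordinate[OF space_with_functions_V, of i ?N']
          morphism_coordinate[OF space_with_functions_V, of "N + i" ?N'] that
        by (cases "i < n") (simp_all add: \<rho>_def)
    qed (simp add: \<rho>_def)
    let ?U\<pi> = "{z \<in> points ?P'. \<pi> z \<in> U}" and ?U\<rho> = "{z \<in> points ?P'. \<rho> z \<in> U}"
    let ?U' = "?U\<pi> \<inter> ?U\<rho>"
    have U\<pi>: "openin (zariski ?P') ?U\<pi>" and U\<rho>: "openin (zariski ?P') ?U\<rho>"
      using morphism_openin_vimage[OF \<pi> U] morphism_openin_vimage[OF \<rho> U] .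
    then have U': "openin (zariski ?P') ?U'" by blast
    have reg_\<pi>: "regular ?P' ?U' (\<lambda>z. g j (\<pi> z))" if "j \<in> J" for j
      by (rule regular_subset[OF sP' U\<pi> U' _ morphism_regular[OF \<pi> U]]) (use g that in auto)
    have reg_\<rho>: "regular ?P' ?U' (\<lambda>z. g j (\<rho> z))" if "j \<in> J" for j
      by (rule regular_subset[OF sP' U\<rho> U' _ morphism_regular[OF \<rho> U]]) (use g that in auto)
    \<comment> \<open>Two-by-two minors of the coefficient functions at the two glued points.
      Cross-multiplying instead of dividing by \<open>g k (\<rho> z)\<close> keeps them regular on
      all of \<open>?U'\<close>, and the minor for \<open>j = k\<close> vanishes, which removes a
      term.\<close>
    define g' where "g' k j z = g k (\<rho> z) * g j (\<pi> z) - g j (\<rho> z) * g k (\<pi> z)" for k j z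
    have reg': "regular ?P' ?U' (g' k j)" if "k \<in> J" "j \<in> J" for k j
      unfolding g'_def
      by (intro regular_diff[OF sP' U'] regular_mult[OF sP' U'] reg_\<pi> reg_\<rho> that)
    \<comment> \<open>The closed set outside which some \<open>g j\<close> is defined and nonzero;
      its fibres are the solution sets that do not depend on \<open>h\<close>.\<close>
    define Y where "Y = points ?P - (\<Union>j\<in>J. {z \<in> U. g j z \<noteq> 0})"
    have "closedin (zariski ?P) Y"
      unfolding Y_def using openin_nonvanishing[OF sP U] g by (intro closedin_diff) auto
    note closed = uniform_cosets_fibres[OF N0 this, of n]
    define \<A> where "\<A> k = {{x \<in> set_power n \<Gamma>. glue n ?N' x y \<in> ?U' \<longrightarrow>
        (\<Sum>j\<in>J - {k}. g' k j (glue n ?N' x y) * h j) = 0} |y h. y \<in> set_power ?N' \<Gamma>}" for k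
    have \<A>: "uniform_cosets (group_power n G) (set_power n \<Gamma>) (\<A> k)" if k: "k \<in> J" for k
    proof -
      have "J - {k} \<subset> J" using k by blast
      from psubset.IH[OF this, rule_format, of ?N' ?U' "g' k"] show ?thesis
        unfolding \<A>_def using U' reg'[OF k] by simp
    qed
    show "uniform_cosets (group_power n G) (set_power n \<Gamma>)
      {{x \<in> set_power n \<Gamma>. glue n N x y \<in> U \<longrightarrow> (\<Sum>j\<in>J. g j (glue n N x y) * h j) = 0} |y h.
        y \<in> set_power N \<Gamma>}"
    proof (rule uniform_cosets_subset[OF uniform_cosets_Un[OF closed uniform_cosets_UN[OF psubset.hyps \<A>]]],
        assumption, rule subsetI)
      fix A
      assume "A \<in> {{x \<in> set_power n \<Gamma>. glue n N x y \<in> U \<longrightarrow> (\<Sum>j\<in>J. g j (glue n N x y) * h j) = 0} |y h.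
        y \<in> set_power N \<Gamma>}"
      then obtain y h where y: "y \<in> set_power N \<Gamma>" and
        A: "A = {x \<in> set_power n \<Gamma>. glue n N x y \<in> U \<longrightarrow> (\<Sum>j\<in>J. g j (glue n N x y) * h j) = 0}"
        by blast
      show "A \<in> {{x \<in> set_power n \<Gamma>. glue n N x y \<in> Y} |y. y \<in> set_power N \<Gamma>} \<union> (\<Union>k\<in>J. \<A> k)"
      proof (cases "\<exists>x1\<in>A. glue n N x1 y \<in> U \<and> (\<exists>k\<in>J. g k (glue n N x1 y) \<noteq> 0)")
        \<comment> \<open>Every solution inside \<open>U\<close> makes all \<open>g j\<close>
          vanish, and conversely vanishing of all \<open>g j\<close> solves the equation, so the
          solution set is a fibre of \<open>Y\<close>.\<close>
        case False
        have "glue n N x y \<in> Y \<longleftrightarrow> (glue n N x y \<in> U \<longrightarrow> (\<Sum>j\<in>J. g j (glue n N x y) * h j) = 0)"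
          if x: "x \<in> set_power n \<Gamma>" for x
        proof -
          have "glue n N x y \<in> points ?P"
            using glue_in_PiE[OF x y] subgroup.subset[OF \<Gamma>] unfolding points_power by auto
          then have *: "glue n N x y \<in> Y \<longleftrightarrow> (glue n N x y \<in> U \<longrightarrow> (\<forall>j\<in>J. g j (glue n N x y) = 0))"
            by (auto simp: Y_def)
          show ?thesis
          proof
            assume "glue n N x y \<in> Y"
            then show "glue n N x y \<in> U \<longrightarrow> (\<Sum>j\<in>J. g j (glue n N x y) * h j) = 0"
              using * by simp
          next
            assume "glue n N x y \<in> U \<longrightarrow> (\<Sum>j\<in>J. g j (glue n N x y) * h j) = 0"
            then have "x \<in> A" using x A by blast
            then show "glue n N x y \<in> Y" using False * by blast
          qed
        qed
        then have "A = {x \<in> set_power n \<Gamma>. glue n N x y \<in> Y}" unfolding A by blast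
        then show ?thesis using y by blast
      next
        case True
        then obtain x1 k where x1: "x1 \<in> A" "glue n N x1 y \<in> U" and k: "k \<in> J" "g k (glue n N x1 y) \<noteq> 0"
          by blast
        define a where "a j = g j (glue n N x1 y)" for j
        have x1\<Gamma>: "x1 \<in> set_power n \<Gamma>" and sum1: "(\<Sum>j\<in>J. a j * h j) = 0" using x1 A a_def by auto
        \<comment> \<open>The old parameter with \<open>x1\<close> appended as the coordinates
          \<open>N\<close> to \<open>N + n - 1\<close>. It still has all entries in \<Gamma>,
          because \<open>x1\<close> is a solution taken from the power of \<Gamma>.\<close>
        define y' where "y' = (\<lambda>i\<in>{..<?N'}. if i < N then y i else x1 (i - N))"
        have y': "y' \<in> set_power ?N' \<Gamma>"
          using y x1\<Gamma> by (auto simp: y'_def PiE_iff)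
        have "(glue n ?N' x y' \<in> ?U' \<longrightarrow> (\<Sum>j\<in>J - {k}. g' k j (glue n ?N' x y') * h j) = 0) \<longleftrightarrow>
            (glue n N x y \<in> U \<longrightarrow> (\<Sum>j\<in>J. g j (glue n N x y) * h j) = 0)"
          if x: "x \<in> set_power n \<Gamma>" for x
        proof -
          let ?z = "glue n ?N' x y'"
          have \<pi>z: "\<pi> ?z = glue n N x y"
            by (auto simp: \<pi>_def glue_def y'_def fun_eq_iff)
          have \<rho>z: "\<rho> ?z = glue n N x1 y"
            using N by (auto simp: \<rho>_def glue_def y'_def fun_eq_iff)
          have "?z \<in> points ?P'"
            using glue_in_PiE[OF x y'] subgroup.subset[OF \<Gamma>] unfolding points_power by auto
          \<comment> \<open>The second glued point lies in \<open>U\<close> by the choice of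
            \<open>x1\<close>, so only the condition on the first one remains.\<close>
          then have mem: "?z \<in> ?U' \<longleftrightarrow> glue n N x y \<in> U" using \<pi>z \<rho>z x1(2) by simp
          define b where "b j = g j (glue n N x y)" for j
          \<comment> \<open>The equation at \<open>x1\<close>, solved for its \<open>k\<close>-th
            term. Inserting it turns the reduced sum into \<open>a k\<close> times the full sum at
            \<open>x\<close>, and \<open>a k\<close> is nonzero.\<close>
          have rest: "(\<Sum>j\<in>J - {k}. a j * h j) = - (a k * h k)"
            using sum1 sum.remove[OF psubset.hyps k(1), of "\<lambda>j. a j * h j"] by (simp add: eq_neg_iff_add_eq_0 add.commute)
          have "(\<Sum>j\<in>J - {k}. g' k j ?z * h j) = (\<Sum>j\<in>J - {k}. a k * (b j * h j) - b k * (a j * h j))"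
            unfolding g'_def \<pi>z \<rho>z a_def b_def by (rule sum.cong) (auto simp: algebra_simps)
          also have "\<dots> = a k * (\<Sum>j\<in>J - {k}. b j * h j) - b k * (\<Sum>j\<in>J - {k}. a j * h j)"
            by (simp add: sum_subtractf sum_distrib_left)
          also have "\<dots> = a k * (\<Sum>j\<in>J. b j * h j)"
            unfolding rest sum.remove[OF psubset.hyps k(1), of "\<lambda>j. b j * h j"] by (simp add: algebra_simps)
          finally have "(\<Sum>j\<in>J - {k}. g' k j ?z * h j) = 0 \<longleftrightarrow> (\<Sum>j\<in>J. g j (glue n N x y) * h j) = 0"
            using k(2) by (simp add: a_def b_def)
          then show ?thesis using mem by blast
        qed
        then have "A = {x \<in> set_power n \<Gamma>. glue n ?N' x y' \<in> ?U' \<longrightarrow>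
            (\<Sum>j\<in>J - {k}. g' k j (glue n ?N' x y') * h j) = 0}" unfolding A by blast
        then have "A \<in> \<A> k" unfolding \<A>_def using y' by blast
        then show ?thesis using k(1) by blast
      qed
    qed
  qed
qed

end

section \<open>Families of subvarieties and the closures of their fibres\<close>

context Lang_type_subgroup
begin

text \<open>For fixed \<open>b\<close>, each pair in \<open>F\<close> imposes no condition or one
  equation with coefficients \<open>h j b\<close>, to which \<open>uniform_cosets_linear\<close>
  applies with \<open>N = n\<close>. Intersecting over the finite set \<open>F\<close> preserves
  uniformity.\<close>

lemma uniform_cosets_equations:
  assumes n: "n > 0" and "finite F" "F \<subseteq> prod_functions (power_space n V) B"
  shows "uniform_cosets (group_power n G) (set_power n \<Gamma>)
    (range (\<lambda>b. {x \<in> set_power n \<Gamma>. \<forall>(D, f)\<in>F. (x, b) \<in> D \<longrightarrow> f (x, b) = 0}))"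
  using assms(2,3)
proof (induction F rule: finite_induct)
  case empty
  show ?case
    by (rule uniform_cosets_subset[OF group.uniform_cosets_whole[OF group_group_power set_power_subgroup]]) auto
next
  case (insert p F)
  let ?M = "group_power n G" and ?\<Delta> = "set_power n \<Gamma>"
  obtain D f where p: "p = (D, f)" by (cases p)
  then have "(D, f) \<in> prod_functions (power_space n V) B" using insert.prems by blast
  then obtain U W m g h where D: "D = U \<times> W" "f = (\<lambda>(x, y). \<Sum>j<(m::nat). g j x * h j y)"
    "openin (zariski (power_space n V)) U" "openin (zariski B) W"
    "\<And>j. j < m \<Longrightarrow> regular (power_space n V) U (g j)" "\<And>j. j < m \<Longrightarrow> regular B W (h j)"
    by (elim prod_functionsE) (rule that)
  let ?\<A> = "{{x \<in> ?\<Delta>. glue n n x y \<in> U \<longrightarrow> (\<Sum>j\<in>{..<m}. g j (glue n n x y) * c j) = 0} |y c. y \<in> ?\<Delta>}"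
  let ?S = "\<lambda>b. {x \<in> ?\<Delta>. (x, b) \<in> D \<longrightarrow> f (x, b) = 0}"
  let ?R = "\<lambda>b. {x \<in> ?\<Delta>. \<forall>(D, f)\<in>F. (x, b) \<in> D \<longrightarrow> f (x, b) = 0}"
  have "uniform_cosets ?M ?\<Delta> ?\<A>"
    using uniform_cosets_linear[OF n finite_lessThan[of m], rule_format, of n U g] D(3,5) by simp
  then have *: "uniform_cosets ?M ?\<Delta> ({?\<Delta>} \<union> ?\<A>)"
    by (rule uniform_cosets_Un[OF group.uniform_cosets_whole[OF group_group_power set_power_subgroup]])
  have S: "?S b \<in> {?\<Delta>} \<union> ?\<A>" for b
  proof (cases "b \<in> W")
    case False
    then have "?S b = ?\<Delta>" by (auto simp: D(1))
    then show ?thesis by blast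
  next
    case True
    have "((x, b) \<in> D \<longrightarrow> f (x, b) = 0) \<longleftrightarrow> (glue n n x \<one>\<^bsub>?M\<^esub> \<in> U \<longrightarrow>
        (\<Sum>j\<in>{..<m}. g j (glue n n x \<one>\<^bsub>?M\<^esub>) * h j b) = 0)" if "x \<in> ?\<Delta>" for x
      using True by (simp add: D(1,2) glue_same[OF that])
    then have eq: "?S b = {x \<in> ?\<Delta>. glue n n x \<one>\<^bsub>?M\<^esub> \<in> U \<longrightarrow>
        (\<Sum>j\<in>{..<m}. g j (glue n n x \<one>\<^bsub>?M\<^esub>) * h j b) = 0}" by blast
    \<comment> \<open>The parameter is ignored by \<open>glue n n\<close>; the identity is just a
      convenient point of the power of \<Gamma>.\<close>
    have "?S b \<in> ?\<A>"
      by (intro CollectI exI[of _ "\<one>\<^bsub>?M\<^esub>"] exI[of _ "\<lambda>j. h j b"] conjI eq one_in_set_power)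
    then show ?thesis by blast
  qed
  have "range (\<lambda>b. {x \<in> ?\<Delta>. \<forall>(D, f)\<in>insert p F. (x, b) \<in> D \<longrightarrow> f (x, b) = 0}) \<subseteq>
      {A \<inter> C |A C. A \<in> {?\<Delta>} \<union> ?\<A> \<and> C \<in> range ?R}"
  proof (rule image_subsetI)
    fix b
    have eq: "{x \<in> ?\<Delta>. \<forall>(D, f)\<in>insert p F. (x, b) \<in> D \<longrightarrow> f (x, b) = 0} = ?S b \<inter> ?R b"
      unfolding p by (simp only: ball_simps prod.case) blast
    show "{x \<in> ?\<Delta>. \<forall>(D, f)\<in>insert p F. (x, b) \<in> D \<longrightarrow> f (x, b) = 0} \<in>
        {A \<inter> C |A C. A \<in> {?\<Delta>} \<union> ?\<A> \<and> C \<in> range ?R}"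
      unfolding eq by (rule CollectI, intro exI conjI) (rule refl S rangeI)+
  qed
  moreover have "uniform_cosets ?M ?\<Delta> (range ?R)"
    by (rule insert.IH) (use insert.prems in blast)
  from group.uniform_cosets_Int[OF group_group_power set_power_subgroup * this]
  have "uniform_cosets ?M ?\<Delta> {A \<inter> C |A C. A \<in> {?\<Delta>} \<union> ?\<A> \<and> C \<in> range ?R}" .
  ultimately show ?case by (rule uniform_cosets_subset[rotated])
qed

lemma uniform_cosets_family:
  assumes n: "n > 0" and B: "variety B"
    and X: "closedin (zariski (prod_space (power_space n V) B)) X"
  shows "uniform_cosets (group_power n G) (set_power n \<Gamma>)
    ((\<lambda>b. {x. (x, b) \<in> X} \<inter> set_power n \<Gamma>) ` points B)"
proof -
  let ?P = "prod_space (power_space n V) B"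
  note sV = space_with_functions_power_space[OF space_with_functions_V n]
  note sB = variety_space_with_functions[OF B]
  have "openin (zariski ?P) (points ?P - X)" using X by blast
  from noetherian_open_finite_union[OF fraction_family_prod_functions[OF sV sB], folded prod_space_eq,
      OF noetherian_prod_power_space[OF variety B n] this]
  obtain F where F: "F \<subseteq> prod_functions (power_space n V) B" "finite F"
    "points ?P - X = (\<Union>(D, f)\<in>F. {x \<in> D. f x \<noteq> 0})" by (elim exE conjE)
  have "{x. (x, b) \<in> X} \<inter> set_power n \<Gamma> =
      {x \<in> set_power n \<Gamma>. \<forall>(D, f)\<in>F. (x, b) \<in> D \<longrightarrow> f (x, b) = 0}" if b: "b \<in> points B" for b
  proof -
    have "(x, b) \<in> X \<longleftrightarrow> (\<forall>(D, f)\<in>F. (x, b) \<in> D \<longrightarrow> f (x, b) = 0)" if "x \<in> set_power n \<Gamma>" for x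
    proof -
      have "(x, b) \<in> points ?P"
        using b that set_power_subset[of n] by (auto simp: points_prod_space[OF sV sB] points_power)
      then have "(x, b) \<in> X \<longleftrightarrow> (x, b) \<notin> (\<Union>(D, f)\<in>F. {x \<in> D. f x \<noteq> 0})"
        unfolding F(3)[symmetric] by blast
      then show ?thesis by auto
    qed
    then show ?thesis by blast
  qed
  then show ?thesis
    by (intro uniform_cosets_subset[OF uniform_cosets_equations[OF n F(2,1)]]) blast
qed

text \<open>Closure commutes with finite unions and with translation. The map \<open>e\<close> lists
  every subgroup \<open>N\<close> times, so cosets of the same subgroup can be given different
  indices.\<close>

lemma closure_of_union_of_cosets:
  assumes n: "n > 0" and \<S>: "finite \<S>" "\<And>S. S \<in> \<S> \<Longrightarrow> subgroup S (group_power n G)"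
    and e: "bij_betw e {1..m::nat} (\<S> \<times> {..<N})"
    and A: "union_of_cosets (group_power n G) (set_power n \<Gamma>) \<S> N A"
  shows "\<exists>I \<gamma>. I \<subseteq> {1..m} \<and> (\<forall>i\<in>{1..m}. \<gamma> i \<in> set_power n \<Gamma>) \<and>
    zariski (power_space n V) closure_of A =
      (\<Union>i\<in>I. \<gamma> i <#\<^bsub>group_power n G\<^esub> (zariski (power_space n V) closure_of fst (e i)))"
proof -
  let ?M = "group_power n G" and ?T = "zariski (power_space n V)"
  obtain \<C> where \<C>: "finite \<C>" "card \<C> \<le> N" "A = \<Union>\<C>"
    "\<forall>C\<in>\<C>. \<exists>\<gamma>\<in>set_power n \<Gamma>. \<exists>S\<in>\<S>. C = \<gamma> <#\<^bsub>?M\<^esub> S"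
    using A unfolding union_of_cosets_def by (elim exE conjE)
  obtain \<gamma> S where S: "\<And>C. C \<in> \<C> \<Longrightarrow> \<gamma> C \<in> set_power n \<Gamma>" "\<And>C. C \<in> \<C> \<Longrightarrow> S C \<in> \<S>"
    "\<And>C. C \<in> \<C> \<Longrightarrow> C = \<gamma> C <#\<^bsub>?M\<^esub> S C" using \<C>(4) by metis
  obtain c where c: "c ` \<C> \<subseteq> {..<N}" "inj_on c \<C>"
    using card_le_inj[OF \<C>(1), of "{..<N}"] \<C>(2) by auto
  \<comment> \<open>The index of \<open>C\<close> is the copy of its subgroup numbered by
    \<open>c C\<close>; injectivity of \<open>c\<close> makes \<open>k\<close> injective even when
    subgroups repeat.\<close>
  define k where "k C = inv_into {1..m} e (S C, c C)" for C
  have mem: "(S C, c C) \<in> e ` {1..m}" if "C \<in> \<C>" for C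
    using S(2)[OF that] c(1) that e by (auto simp: bij_betw_def)
  have k: "k C \<in> {1..m}" "e (k C) = (S C, c C)" if "C \<in> \<C>" for C
    unfolding k_def using inv_into_into[OF mem[OF that]] f_inv_into_f[OF mem[OF that]] .
  have inj: "inj_on k \<C>"
  proof (rule inj_onI)
    fix C D assume CD: "C \<in> \<C>" "D \<in> \<C>" "k C = k D"
    have "c C = c D" using k(2)[OF CD(1)] k(2)[OF CD(2)] CD(3) by simp
    from inj_onD[OF c(2) this CD(1,2)] show "C = D" .
  qed
  define \<delta> where "\<delta> i = (if i \<in> k ` \<C> then \<gamma> (inv_into \<C> k i) else \<one>\<^bsub>?M\<^esub>)" for i
  have \<delta>: "\<delta> (k C) = \<gamma> C" if "C \<in> \<C>" for C
    using that inj by (simp add: \<delta>_def inv_into_f_f)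
  have "?T closure_of C = \<delta> (k C) <#\<^bsub>?M\<^esub> (?T closure_of fst (e (k C)))" if C: "C \<in> \<C>" for C
  proof -
    have "?T closure_of (\<gamma> C <#\<^bsub>?M\<^esub> S C) = \<gamma> C <#\<^bsub>?M\<^esub> (?T closure_of S C)"
      by (rule closure_of_power_coset[OF n subgroup.subset[OF \<S>(2)[OF S(2)[OF C]]]
            subsetD[OF set_power_subset S(1)[OF C]]])
    then show ?thesis using S(3)[OF C] \<delta>[OF C] k(2)[OF C] by (metis fst_conv)
  qed
  then have "(\<Union>C\<in>\<C>. ?T closure_of C) = (\<Union>i\<in>k ` \<C>. \<delta> i <#\<^bsub>?M\<^esub> (?T closure_of fst (e i)))"
    unfolding image_image by (rule SUP_cong[OF refl])
  then have closure: "?T closure_of A = (\<Union>i\<in>k ` \<C>. \<delta> i <#\<^bsub>?M\<^esub> (?T closure_of fst (e i)))"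
    unfolding \<C>(3) closure_of_Union[OF \<C>(1)] .
  have "\<delta> i \<in> set_power n \<Gamma>" for i
    unfolding \<delta>_def using S(1)[OF inv_into_into[of i k \<C>]] one_in_set_power by presburger
  moreover have "k ` \<C> \<subseteq> {1..m}" using k(1) by blast
  ultimately show ?thesis using closure by (intro exI[of _ "k ` \<C>"] exI[of _ \<delta>] conjI ballI)
qed

end

theorem theorem1:
  fixes G :: "'a monoid" and V :: "('a, 'k::alg_closed_field) fun_space" and \<Gamma> :: "'a set"
  assumes "algebraic_group G V"
    and "subgroup \<Gamma> G"
    and "Lang_type G V \<Gamma>"
  shows "uniformly_Lang_type TYPE('b) G V \<Gamma>"
  unfolding uniformly_Lang_type_def
proof (intro conjI allI impI; (elim conjE)?)
  interpret Lang_type_subgroup G V \<Gamma>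
    using assms by (simp add: Lang_type_subgroup_def Lang_type_subgroup_axioms_def)
  fix n :: nat and B :: "('b, 'k) fun_space" and X
  assume "1 \<le> n" and B: "variety B" and X: "closedin (zariski (prod_space (power_space n V) B)) X"
  then have n: "n > 0" by simp
  from uniform_cosets_family[OF n B X] obtain \<S> N where
    \<S>: "finite \<S>" "\<And>S. S \<in> \<S> \<Longrightarrow> subgroup S (group_power n G)" "\<And>S. S \<in> \<S> \<Longrightarrow> S \<subseteq> set_power n \<Gamma>"
    "\<And>A. A \<in> (\<lambda>b. {x. (x, b) \<in> X} \<inter> set_power n \<Gamma>) ` points B \<Longrightarrow>
      union_of_cosets (group_power n G) (set_power n \<Gamma>) \<S> N A"
    by (elim uniform_cosetsE) (rule that)
  \<comment> \<open>A fibre may contain up to \<open>N\<close> cosets of one subgroup, hence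
    \<open>N\<close> copies of each. The set depends only on the family, and so does the sequence
    enumerated from it.\<close>
  have "finite (\<S> \<times> {..<N})" using \<S>(1) by simp
  from ex_bij_betw_nat_finite_1[OF this] obtain m e where e: "bij_betw e {1..m::nat} (\<S> \<times> {..<N})" by blast
  let ?H = "\<lambda>i. zariski (power_space n V) closure_of fst (e i)"
  have "algebraic_subgroup n G V (?H i)" if "i \<in> {1..m}" for i
  proof -
    have "e i \<in> \<S> \<times> {..<N}" using bij_betwE[OF e] that by blast
    then have "fst (e i) \<in> \<S>" by (simp add: mem_Times_iff)
    from algebraic_subgroup_closure_of[OF n \<S>(2)[OF this]] show ?thesis .
  qed
  moreover have "\<exists>I \<gamma>. I \<subseteq> {1..m} \<and> (\<forall>i\<in>{1..m}. \<gamma> i \<in> set_power n \<Gamma>) \<and>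
      zariski (power_space n V) closure_of ({x. (x, b) \<in> X} \<inter> set_power n \<Gamma>) =
        (\<Union>i\<in>I. \<gamma> i <#\<^bsub>group_power n G\<^esub> ?H i)" if "b \<in> points B" for b
    by (rule closure_of_union_of_cosets[OF n \<S>(1,2) e \<S>(4)]) (use that in blast)+
  ultimately show "\<exists>m H. (\<forall>i\<in>{1..m::nat}. algebraic_subgroup n G V (H i)) \<and>
      (\<forall>b\<in>points B. \<exists>I \<gamma>. I \<subseteq> {1..m} \<and> (\<forall>i\<in>{1..m}. \<gamma> i \<in> set_power n \<Gamma>) \<and>
         zariski (power_space n V) closure_of ({x. (x, b) \<in> X} \<inter> set_power n \<Gamma>) =
           (\<Union>i\<in>I. \<gamma> i <#\<^bsub>group_power n G\<^esub> H i))"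
    by (intro exI[of _ m] exI[of _ ?H] conjI ballI)
qed (rule assms(3))

end
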